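(* Let $\Omega\subset\mathbb{R}^2$ be an open connected set, let $f:\Omega\to\mathbb{R}$ be a $C^2$ function with no critical points in $\Omega$, and let $a<b$ be two numbers in $f[\Omega]$ such that $f^{-1}[[a,b]]$ is connected and compact. Then $$\iint_{f^{-1}[[a,b]]} D_{\mathbf{T}}^{2}f\,dA=\sigma\cdot 2\pi(b-a),$$ where $D_{\mathbf{T}}^2 f$ is the function $p\mapsto D^2_{\mathbf{T}(p)}f(p)$ and $\sigma\in\{1,-1\}$ is the constant orientation sign of the level curves of $f$ in $f^{-1}[[a,b]]$ (both defined in the context).
   Context: For $p\in\Omega$ and a unit vector $\mathbf{v}\in\mathbb{R}^2$, the second-order directional derivative $D_{\mathbf{v}}^2f(p)$ is $D''(0)$, where $D(s)=f(p+s\mathbf{v})$ for $s$ near $0$; equivalently, $D_{\mathbf{v}}^2f(p)=\mathbf{v}\cdot(H_p\mathbf{v})$, where $H_p$ is the Hessian matrix of $f$ at $p$. For $p=(x,y)\in\Omega$, $\mathbf{T}(p)=(-f_y(p),f_x(p))/|\nabla f(p)|$ is a unit tangent vector at $p$ to the level curve $f^{-1}[f(p)]$, and $\mathbf{N}(p)=-\nabla f(p)/|\nabla f(p)|$ is the chosen unit normal. $dA$ is the area element in the plane. Under the stated hypotheses, for every $t\in[a,b]$ the level set $f^{-1}[t]$ is a simple closed $C^2$ curve. For $p\in f^{-1}[[a,b]]$, let $\mathbf{n}(p)$ be the unit normal at $p$ to the simple closed curve $f^{-1}[f(p)]$ pointing inward, i.e., toward the Jordan domain (bounded region) enclosed by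 that curve, and let $\sigma(p)=\mathbf{n}(p)\cdot\mathbf{N}(p)\in\{1,-1\}$. The function $\sigma$ is constant on $f^{-1}[[a,b]]$, and its constant value is denoted $\sigma$; $\sigma=1$ if and only if $f^{-1}[b]$ encloses $f^{-1}[a]$. *)

theory Defs
  imports "HOL-Analysis.Analysis"
begin

definition partial_deriv :: "'n::finite \<Rightarrow> (real^'n \<Rightarrow> real) \<Rightarrow> real^'n \<Rightarrow> real" where
  "partial_deriv i f p = deriv (\<lambda>s. f (p + s *\<^sub>R axis i 1)) 0"

definition grad :: "(real^'n \<Rightarrow> real) \<Rightarrow> real^'n \<Rightarrow> real^'n" where
  "grad f p = (\<chi> i. partial_deriv i f p)"

text \<open>\<open>Ck_on k S f\<close> says that \<open>f\<close> is of class \<open>C^k\<close> on \<open>S\<close>; it is meant for open \<open>S\<close>.\<close>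

primrec Ck_on :: "nat \<Rightarrow> (real^'n::finite) set \<Rightarrow> (real^'n \<Rightarrow> real) \<Rightarrow> bool" where
  "Ck_on 0 S f \<longleftrightarrow> continuous_on S f"
| "Ck_on (Suc k) S f \<longleftrightarrow>
     (\<forall>p\<in>S. f differentiable (at p)) \<and> (\<forall>i. Ck_on k S (partial_deriv i f))"

definition dir_deriv2 :: "(real^'n \<Rightarrow> real) \<Rightarrow> real^'n \<Rightarrow> real^'n \<Rightarrow> real" where
  "dir_deriv2 f v p = (deriv ^^ 2) (\<lambda>s. f (p + s *\<^sub>R v)) 0"

definition unit_tangent :: "(real^2 \<Rightarrow> real) \<Rightarrow> real^2 \<Rightarrow> real^2" where
  "unit_tangent f p =
     vector [- partial_deriv 2 f p, partial_deriv 1 f p] /\<^sub>R norm (grad f p)"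

definition unit_normal :: "(real^2 \<Rightarrow> real) \<Rightarrow> real^2 \<Rightarrow> real^2" where
  "unit_normal f p = - (grad f p /\<^sub>R norm (grad f p))"

text \<open>The functions of interest live on an open set \<open>\<Omega>\<close> only, so preimages are taken in \<open>\<Omega>\<close>.\<close>

definition preimage_in :: "'a set \<Rightarrow> ('a \<Rightarrow> 'b) \<Rightarrow> 'b set \<Rightarrow> 'a set" where
  "preimage_in \<Omega> f I = {p \<in> \<Omega>. f p \<in> I}"

definition tangent_vectors :: "'a::real_normed_vector set \<Rightarrow> 'a \<Rightarrow> 'a set" where
  "tangent_vectors \<Gamma> p =
     {v. \<exists>c. c 0 = p \<and> (\<forall>\<^sub>F s in nhds (0::real). c s \<in> \<Gamma>) \<and> (c has_vector_derivative v) (at 0)}"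

text \<open>
  For a simple closed curve \<open>\<Gamma>\<close> in the plane, given as a point set, \<open>inside \<Gamma>\<close> is the Jordan
  domain bounded by \<open>\<Gamma>\<close>. If \<open>\<Gamma>\<close> is moreover regular and of class \<open>C^1\<close>, then
  \<open>tangent_vectors \<Gamma> p\<close> is its tangent line at \<open>p\<close>, and the vector below is unique.
\<close>

definition inward_unit_normal :: "(real^2) set \<Rightarrow> real^2 \<Rightarrow> real^2" where
  "inward_unit_normal \<Gamma> p =
     (THE n. norm n = 1 \<and> (\<forall>v\<in>tangent_vectors \<Gamma> p. n \<bullet> v = 0) \<and>
             (\<forall>\<^sub>F s in at_right (0::real). p + s *\<^sub>R n \<in> inside \<Gamma>))"

definition orientation_sign :: "(real^2) set \<Rightarrow> (real^2 \<Rightarrow> real) \<Rightarrow> real^2 \<Rightarrow> real" where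
  "orientation_sign \<Omega> f p =
     inward_unit_normal (preimage_in \<Omega> f {f p}) p \<bullet> unit_normal f p"

end

theory Submission
  imports Defs
begin

text \<open>
  If \<open>\<theta>\<close> is a local argument of \<open>\<nabla>f\<close>, then \<open>D\<^sub>T\<^sup>2 f = f\<^sub>x \<theta>\<^sub>y - f\<^sub>y \<theta>\<^sub>x\<close>, so the integrand is the derivative of \<open>\<theta>\<close>
  along the Hamiltonian field \<open>X = (-f\<^sub>y, f\<^sub>x)\<close>. The flow of \<open>\<nabla>f / |\<nabla>f|\<^sup>2\<close> retracts \<open>f\<^sup>-\<^sup>1[[a,b]]\<close>
  onto each level set, which is therefore connected, hence a single periodic orbit of \<open>X\<close>. By the
  coarea formula the integral is the integral over \<open>t \<in> [a,b]\<close> of the total change of \<open>\<theta>\<close> along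
  the level curve of \<open>t\<close>, and this change is \<open>\<plusminus>2\<pi>\<close> by Hopf's theorem on the turning number. The sign
  in Hopf's theorem is the sign of \<open>-f\<^sub>y\<close> at a lowest point of the curve. It equals the orientation sign,
  because the half plane below such a point is outside the curve, and it does not depend on \<open>t\<close>,
  because limits of lowest points of level curves are lowest points.
\<close>

subsection \<open>Global flows of bounded Lipschitz vector fields\<close>

text \<open>Hamiltonian time \<open>s\<close> as the parameter of the level curves makes the two
  halves of the argument fit. Since \<open>ds\<close> is arc length divided by
  \<open>norm (G p)\<close>, the area element is \<open>ds dt\<close> without any density, and the
  rate at which \<open>X\<close> turns per unit of \<open>s\<close> is exactly the integrand.

  The fields live on \<open>\<Omega>\<close> only, so neither flow is complete a priori. Each field
  is therefore cut off, away from the compact annulus, to a bounded Lipschitz field on the whole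
  plane. The growth law of \<open>f\<close> along a trajectory (constant for \<open>X\<close>, unit
  rate for \<open>Y\<close>) then keeps it in the annulus as long as the predicted value lies in
  \<open>{a..b}\<close>.

  A level curve can have several lowest points, and these need not depend continuously on the level.
  The sign is thus not followed along a continuous choice: the levels of either sign form two
  disjoint closed sets covering the connected interval \<open>{a..b}\<close>. Reading turning number
  and orientation at the same lowest point is what identifies the sign in Hopf's theorem with the
  geometric one.\<close>

lemma antiderivative_exists:
  fixes h :: "real \<Rightarrow> 'a::euclidean_space"
  assumes "continuous_on UNIV h"
  shows "\<exists>J. J 0 = 0 \<and> (\<forall>s. (J has_vector_derivative h s) (at s))"
proof -
  define J where "J s = (if 0 \<le> s then integral {0..s} h else - integral {s..0} h)" for s
  have int: "h integrable_on {u..v}" for u v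
    using assms continuous_on_subset integrable_continuous_interval by blast
  \<comment> \<open>Rebasing at a point \<open>c\<close> to the left of both \<open>0\<close> and
    \<open>u\<close> removes the case split at \<open>0\<close>, where the two defining formulas
    meet.\<close>
  have J: "J u = integral {c..u} h - integral {c..0} h" if "c \<le> u" "c \<le> 0" for c u
  proof (cases "0 \<le> u")
    case True
    then have "integral {c..0} h + integral {0..u} h = integral {c..u} h"
      using that int by (intro Henstock_Kurzweil_Integration.integral_combine) auto
    then show ?thesis using True by (simp add: J_def algebra_simps)
  next
    case False
    then have "integral {c..u} h + integral {u..0} h = integral {c..0} h"
      using that int by (intro Henstock_Kurzweil_Integration.integral_combine) auto
    then show ?thesis using False by (simp add: J_def algebra_simps)
  qed
  have "(J has_vector_derivative h s) (at s)" for s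
  proof -
    define c where "c = - \<bar>s\<bar> - 1"
    define d where "d = \<bar>s\<bar> + 1"
    have s: "s \<in> {c<..<d}" "c \<le> 0" by (auto simp: c_def d_def)
    have "((\<lambda>u. integral {c..u} h) has_vector_derivative h s) (at s within {c..d})"
      using assms s by (intro integral_has_vector_derivative) (auto intro: continuous_on_subset)
    then have "((\<lambda>u. integral {c..u} h) has_vector_derivative h s) (at s)"
      using s by (metis at_within_Icc_at greaterThanLessThan_iff)
    then have D: "((\<lambda>u. integral {c..u} h - integral {c..0} h) has_vector_derivative h s) (at s)"
      by (auto intro!: derivative_eq_intros)
    show ?thesis
      by (rule has_vector_derivative_transform_within_open[OF D, of "{c<..<d}"]) (use s J[of c] in auto)
  qed
  moreover have "J 0 = 0" by (simp add: J_def)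
  ultimately show ?thesis by blast
qed

lemma has_vector_derivative_reflect:
  fixes F :: "real \<Rightarrow> 'a::real_normed_vector"
  assumes "(F has_vector_derivative F') (at (- s))"
  shows "((\<lambda>s. F (- s)) has_vector_derivative - F') (at s)"
proof -
  have "((\<lambda>s::real. - s) has_vector_derivative - 1) (at s)"
    by (auto intro!: derivative_eq_intros)
  from vector_diff_chain_at[OF this] assms show ?thesis by (auto simp: o_def)
qed

text \<open>A majorant of the speed in terms of \<open>\<bar>s\<bar>\<close> bounds the displacement
  in both time directions, negative times by reflection. A linear \<open>\<phi>\<close> will bound
  the Picard iterates, an exponential one will give the contraction.\<close>

lemma norm_le_of_derivative_le:
  fixes F :: "real \<Rightarrow> 'a::real_normed_vector"
  assumes "F 0 = 0" and F: "\<And>s. (F has_vector_derivative F' s) (at s)"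
    and \<phi>: "\<And>s. (\<phi> has_real_derivative \<phi>' s) (at s)"
    and le: "\<And>s. norm (F' s) \<le> \<phi>' \<bar>s\<bar>"
  shows "norm (F s) \<le> \<phi> \<bar>s\<bar> - \<phi> 0"
proof -
  have *: "norm (G u) \<le> \<phi> u - \<phi> 0"
    if "G 0 = 0" "\<And>s. (G has_vector_derivative G' s) (at s)" "\<And>s. norm (G' s) \<le> \<phi>' \<bar>s\<bar>" "0 \<le> u"
    for G :: "real \<Rightarrow> 'a" and G' u
  proof (cases "u = 0")
    case False
    have "norm (G u - G 0) \<le> \<phi> u - \<phi> 0"
    proof (rule differentiable_bound_general)
      show "0 < u" using False that by simp
      show "continuous_on {0..u} G"
        by (meson continuous_at_imp_continuous_on has_vector_derivative_continuous that(2))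
      show "continuous_on {0..u} \<phi>"
        by (meson DERIV_continuous continuous_at_imp_continuous_on \<phi>)
      show "(G has_vector_derivative G' x) (at x)" for x by (fact that)
      show "(\<phi> has_vector_derivative \<phi>' x) (at x)" for x
        using \<phi> by (simp add: has_real_derivative_iff_has_vector_derivative)
      show "norm (G' x) \<le> \<phi>' x" if "0 < x" for x using that \<open>\<And>s. norm (G' s) \<le> \<phi>' \<bar>s\<bar>\<close>[of x] by simp
    qed
    then show ?thesis using that by simp
  qed (use that in simp)
  show ?thesis
  proof (cases "0 \<le> s")
    case True
    then show ?thesis using *[of F F' s] assms by simp
  next
    case False
    have "((\<lambda>s. F (- s)) has_vector_derivative - F' (- s)) (at s)" for s
      by (rule has_vector_derivative_reflect[OF F])
    then have "norm (F (- (- s))) \<le> \<phi> (- s) - \<phi> 0"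
      by (rule *[of "\<lambda>s. F (- s)" "\<lambda>s. - F' (- s)" "- s", rotated])
         (use False assms(1) le[of "- s" for s] in auto)
    then show ?thesis using False by simp
  qed
qed

text \<open>Picard iteration contracts in the weighted norm
  \<open>sup e\<^bsup>-2L|s|\<^esup> |x s - p|\<close>, which gives a solution on all of \<open>\<real>\<close> at once; below
  \<open>u\<close> is the weighted deviation from \<open>p\<close>.\<close>

lemma lipschitz_ode_solution_exists:
  fixes V :: "'a::euclidean_space \<Rightarrow> 'a"
  assumes lip: "L-lipschitz_on UNIV V" and bdd: "\<And>x. norm (V x) \<le> M"
  shows "\<exists>x. x 0 = p \<and> (\<forall>s. (x has_vector_derivative V (x s)) (at s))"
proof -
  \<comment> \<open>\<open>L\<close> may be \<open>0\<close>; the shifted constant is positive, so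
    that the bounds below can divide by it.\<close>
  define K where "K = L + 1"
  have K: "0 < K" and lipK: "norm (V x - V y) \<le> K * norm (x - y)" for x y
  proof -
    show "0 < K" using lipschitz_on_nonneg[OF lip] by (simp add: K_def)
    have "norm (V x - V y) \<le> L * norm (x - y)"
      using lipschitz_onD[OF lip] by (simp add: dist_norm)
    then show "norm (V x - V y) \<le> K * norm (x - y)"
      by (simp add: K_def distrib_right add_increasing2)
  qed
  have contV: "continuous_on UNIV V" using lip by (rule lipschitz_on_continuous_on)
  have M: "0 \<le> M" using bdd[of undefined] norm_ge_zero order_trans by blast
  define w where "w s = exp (- 2 * K * \<bar>s\<bar>)" for s :: real
  define h where "h u s = V (p + inverse (w s) *\<^sub>R apply_bcontfun u s)" for u :: "real \<Rightarrow>\<^sub>C 'a" and s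
  have wpos: "0 < w s" and contw: "continuous_on UNIV w" for s
    unfolding w_def by (auto intro!: continuous_intros)
  have conth: "continuous_on UNIV (h u)" for u
    unfolding h_def using wpos
    by (intro continuous_on_compose2[OF contV] continuous_intros contw) (auto simp: less_imp_neq[symmetric])
  define J where "J u = (SOME J. J 0 = 0 \<and> (\<forall>s. (J has_vector_derivative h u s) (at s)))" for u
  have J0: "J u 0 = 0" and Jd: "(J u has_vector_derivative h u s) (at s)" for u s
    using someI_ex[OF antiderivative_exists[OF conth[of u]]] unfolding J_def by blast+
  have contJ: "continuous_on UNIV (J u)" for u
    by (meson continuous_at_imp_continuous_on has_vector_derivative_continuous Jd)
  \<comment> \<open>Boundedness of \<open>V\<close> enters here: the antiderivative grows at most
    linearly, hence its weighted form is bounded and \<open>T\<close> maps into the bounded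
    continuous functions.\<close>
  have Jbound: "norm (w s *\<^sub>R J u s) \<le> M / (2 * K)" for u s
  proof -
    have "norm (J u s) \<le> M * \<bar>s\<bar> - M * 0"
      by (rule norm_le_of_derivative_le[OF J0 Jd, where \<phi> = "\<lambda>s. M * s" and \<phi>' = "\<lambda>_. M"])
         (auto intro!: derivative_eq_intros simp: h_def bdd)
    moreover have "2 * K * \<bar>s\<bar> \<le> inverse (w s)"
    proof -
      have "2 * K * \<bar>s\<bar> \<le> exp (2 * K * \<bar>s\<bar>)"
        using exp_ge_add_one_self[of "2 * K * \<bar>s\<bar>"] by linarith
      then show ?thesis by (simp add: w_def exp_minus[symmetric])
    qed
    then have "M * (2 * K * \<bar>s\<bar>) * w s \<le> M * inverse (w s) * w s"
      using M wpos[of s] by (intro mult_right_mono mult_left_mono) auto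
    then have "w s * (M * \<bar>s\<bar>) \<le> M / (2 * K)"
      using wpos[of s] K by (simp add: field_simps)
    ultimately show ?thesis using wpos[of s]
      by (simp add: less_imp_le order_trans[OF mult_left_mono])
  qed
  define T where "T u = Bcontfun (\<lambda>s. w s *\<^sub>R J u s)" for u
  have T: "apply_bcontfun (T u) s = w s *\<^sub>R J u s" for u s
  proof -
    have "(\<lambda>s. w s *\<^sub>R J u s) \<in> bcontfun"
      by (rule bcontfun_normI) (use Jbound in \<open>auto intro!: continuous_intros contw contJ\<close>)
    then show ?thesis by (simp add: T_def Bcontfun_inverse)
  qed
  \<comment> \<open>The exponent of the weight is twice the Lipschitz constant, so integrating
    \<open>K * exp (2 * K * s)\<close> gives back half of the weight; this is the contraction
    factor.\<close>
  have "dist (T u) (T v) \<le> 1/2 * dist u v" for u v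
  proof (rule dist_bound)
    fix s
    let ?D = "dist u v"
    have "norm (J u s - J v s) \<le> ?D / 2 * exp (2 * K * \<bar>s\<bar>) - ?D / 2 * exp (2 * K * 0)"
    proof (rule norm_le_of_derivative_le[where F' = "\<lambda>s. h u s - h v s"
          and \<phi>' = "\<lambda>s. K * ?D * exp (2 * K * s)"])
      show "((\<lambda>s. J u s - J v s) has_vector_derivative h u s - h v s) (at s)" for s
        by (auto intro!: derivative_eq_intros Jd)
      show "((\<lambda>s. ?D / 2 * exp (2 * K * s)) has_real_derivative K * ?D * exp (2 * K * s)) (at s)" for s
        by (auto intro!: derivative_eq_intros)
      fix s
      have "norm (h u s - h v s)
          \<le> K * norm (inverse (w s) *\<^sub>R apply_bcontfun u s - inverse (w s) *\<^sub>R apply_bcontfun v s)"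
        unfolding h_def using lipK by (metis add_diff_cancel_left)
      also have "\<dots> = K * (inverse (w s) * dist (apply_bcontfun u s) (apply_bcontfun v s))"
        using wpos[of s] by (simp add: dist_norm flip: scaleR_right_diff_distrib)
      also have "\<dots> \<le> K * (inverse (w s) * ?D)"
        using K wpos[of s] dist_bounded by (intro mult_left_mono) auto
      also have "\<dots> = K * ?D * exp (2 * K * \<bar>s\<bar>)"
        by (simp add: w_def exp_minus[symmetric])
      finally show "norm (h u s - h v s) \<le> K * ?D * exp (2 * K * \<bar>s\<bar>)" .
    qed (simp add: J0)
    also have "\<dots> \<le> ?D / 2 * exp (2 * K * \<bar>s\<bar>)" by simp
    finally have "w s * norm (J u s - J v s) \<le> w s * (?D / 2 * exp (2 * K * \<bar>s\<bar>))"
      using wpos[of s] by (intro mult_left_mono) auto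
    also have "\<dots> = 1/2 * ?D" by (simp add: w_def exp_minus field_simps)
    finally show "dist (apply_bcontfun (T u) s) (apply_bcontfun (T v) s) \<le> 1/2 * ?D"
      using wpos[of s] by (simp add: T dist_norm flip: scaleR_right_diff_distrib)
  qed
  then obtain u where u: "T u = u"
    using banach_fix_type[of "1/2" T] by auto
  define x where "x s = p + J u s" for s
  have "h u s = V (x s)" for s
  proof -
    have "apply_bcontfun u s = w s *\<^sub>R J u s" using T[of u s] by (simp add: u)
    then have "inverse (w s) *\<^sub>R apply_bcontfun u s = J u s" using wpos[of s] by simp
    then show ?thesis by (simp add: h_def x_def)
  qed
  then have "(x has_vector_derivative V (x s)) (at s)" for s
    unfolding x_def using Jd[of u s] by (auto intro!: derivative_eq_intros)
  then show ?thesis using J0 by (intro exI[of _ x]) (simp add: x_def)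
qed

text \<open>Gronwall's inequality in the form of monotonicity: the squared distance damped by
  \<open>exp (- 2 * L * s)\<close> has nonpositive derivative. Reversing time replaces
  \<open>V\<close> by \<open>- V\<close>, with the same constant. Equal initial values give
  uniqueness.\<close>

lemma lipschitz_ode_solutions_dist:
  fixes V :: "'a::euclidean_space \<Rightarrow> 'a"
  assumes lip: "L-lipschitz_on UNIV V"
    and x: "\<And>s. (x has_vector_derivative V (x s)) (at s)"
    and y: "\<And>s. (y has_vector_derivative V (y s)) (at s)"
  shows "dist (x s) (y s) \<le> exp (L * \<bar>s\<bar>) * dist (x 0) (y 0)"
proof -
  have fwd: "dist (x s) (y s) \<le> exp (L * s) * dist (x 0) (y 0)"
    if lip: "L-lipschitz_on UNIV V" and x: "\<And>s. (x has_vector_derivative V (x s)) (at s)"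
    and y: "\<And>s. (y has_vector_derivative V (y s)) (at s)" and "0 \<le> s"
    for V :: "'a \<Rightarrow> 'a" and x y s
  proof -
    define D where "D s = exp (- 2 * L * s) * ((x s - y s) \<bullet> (x s - y s))" for s
    have "D s \<le> D 0"
    proof (rule DERIV_nonpos_imp_nonincreasing[OF \<open>0 \<le> s\<close>])
      fix r
      have i: "((\<lambda>s. (x s - y s) \<bullet> (x s - y s)) has_real_derivative
              2 * ((x r - y r) \<bullet> (V (x r) - V (y r)))) (at r)"
      proof -
        have "((\<lambda>s. x s - y s) has_derivative (\<lambda>h. h *\<^sub>R (V (x r) - V (y r)))) (at r)"
          using x[of r] y[of r] has_vector_derivative_diff
          unfolding has_vector_derivative_def[symmetric] by blast
        from has_derivative_inner[OF this this] show ?thesis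
          unfolding has_field_derivative_def
          by (rule has_derivative_eq_rhs) (auto simp: inner_commute algebra_simps)
      qed
      have "(D has_real_derivative exp (- 2 * L * r) * (2 * ((x r - y r) \<bullet> (V (x r) - V (y r)))
               - 2 * L * ((x r - y r) \<bullet> (x r - y r)))) (at r)"
        unfolding D_def by (rule derivative_eq_intros i refl | simp add: algebra_simps)+
      moreover have "(x r - y r) \<bullet> (V (x r) - V (y r)) \<le> L * ((x r - y r) \<bullet> (x r - y r))"
      proof -
        have "(x r - y r) \<bullet> (V (x r) - V (y r)) \<le> norm (x r - y r) * norm (V (x r) - V (y r))"
          by (rule norm_cauchy_schwarz)
        also have "\<dots> \<le> norm (x r - y r) * (L * norm (x r - y r))"
          using lipschitz_onD[OF lip, of "x r" "y r"] by (intro mult_left_mono) (auto simp: dist_norm)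
        finally show ?thesis by (simp add: dot_square_norm power2_eq_square mult_ac)
      qed
      ultimately show "\<exists>d. (D has_real_derivative d) (at r) \<and> d \<le> 0"
        by (intro exI conjI) (auto intro!: mult_nonneg_nonpos)
    qed
    then have "(dist (x s) (y s))\<^sup>2 \<le> (exp (L * s) * dist (x 0) (y 0))\<^sup>2"
      by (simp add: D_def dot_square_norm dist_norm power_mult_distrib exp_minus field_simps
          flip: exp_double)
    then show ?thesis by (rule power2_le_imp_le) simp
  qed
  show ?thesis
  proof (cases "0 \<le> s")
    case True
    then show ?thesis using fwd[OF lip x y] by simp
  next
    case False
    have rev: "((\<lambda>s. z (- s)) has_vector_derivative - V (z (- s))) (at s)"
      if "\<And>s. (z has_vector_derivative V (z s)) (at s)" for z s
      by (rule has_vector_derivative_reflect[OF that])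
    have "dist (x (- (- s))) (y (- (- s))) \<le> exp (L * (- s)) * dist (x (- 0)) (y (- 0))"
      by (rule fwd[of "\<lambda>x. - V x"]) (use False x y rev lip in \<open>auto simp: lipschitz_on_minus\<close>)
    then show ?thesis using False by simp
  qed
qed

text \<open>Continuity of the derivative is assumed for one vector \<open>v\<close> at a time. On a
  compact ball this bounds \<open>D p b\<close> for every basis vector \<open>b\<close>, and the sum
  of these bounds dominates the operator norm. The time argument of \<open>local_lipschitz\<close>
  is a dummy.\<close>

lemma C1_imp_local_lipschitz:
  fixes V :: "'a::euclidean_space \<Rightarrow> 'b::real_normed_vector"
  assumes "open \<Omega>"
    and V: "\<And>p. p \<in> \<Omega> \<Longrightarrow> (V has_derivative D p) (at p)"
    and D: "\<And>v. continuous_on \<Omega> (\<lambda>p. D p v)"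
  shows "local_lipschitz T \<Omega> (\<lambda>_. V)"
proof (rule local_lipschitzI)
  fix x assume "x \<in> \<Omega>"
  then obtain u where u: "0 < u" "cball x u \<subseteq> \<Omega>"
    using \<open>open \<Omega>\<close> open_contains_cball by blast
  have "\<exists>B. \<forall>p\<in>cball x u. norm (D p b) \<le> B" for b
  proof -
    have "compact ((\<lambda>p. D p b) ` cball x u)"
      using D u by (intro compact_continuous_image) (auto intro: continuous_on_subset)
    then show ?thesis using compact_imp_bounded bounded_iff by (metis imageI)
  qed
  then obtain B where B: "\<And>b p. p \<in> cball x u \<Longrightarrow> norm (D p b) \<le> B b" by metis
  have "\<bar>sum B Basis\<bar>-lipschitz_on (cball x u \<inter> \<Omega>) V"
  proof (rule lipschitz_onI)
    fix y z assume "y \<in> cball x u \<inter> \<Omega>" "z \<in> cball x u \<inter> \<Omega>"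
    have "norm (V y - V z) \<le> sum B Basis * norm (y - z)"
    proof (rule differentiable_bound[of "cball x u"])
      show "(V has_derivative D p) (at p within cball x u)" if "p \<in> cball x u" for p
        using V u that by (meson has_derivative_at_withinI subsetD)
      fix p assume p: "p \<in> cball x u"
      then interpret linear "D p" using V u has_derivative_linear by blast
      show "onorm (D p) \<le> sum B Basis"
      proof (rule onorm_le)
        fix v
        have "D p v = (\<Sum>b\<in>Basis. (v \<bullet> b) *\<^sub>R D p b)"
          by (subst euclidean_representation[of v, symmetric]) (simp add: sum scale)
        also have "norm \<dots> \<le> (\<Sum>b\<in>Basis. B b * norm v)"
        proof (rule sum_norm_le)
          fix b :: 'a assume "b \<in> Basis"
          then have "\<bar>v \<bullet> b\<bar> * norm (D p b) \<le> norm v * B b"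
            by (intro mult_mono B p Basis_le_norm) auto
          then show "norm ((v \<bullet> b) *\<^sub>R D p b) \<le> B b * norm v" by (simp add: mult.commute)
        qed
        finally show "norm (D p v) \<le> sum B Basis * norm v" by (simp add: sum_distrib_right)
      qed
    qed (use \<open>y \<in> _\<close> \<open>z \<in> _\<close> in auto)
    also have "\<dots> \<le> \<bar>sum B Basis\<bar> * norm (y - z)" by (intro mult_right_mono) auto
    finally show "dist (V y) (V z) \<le> \<bar>sum B Basis\<bar> * dist y z" by (simp add: dist_norm)
  qed simp
  then show "\<exists>u>0. \<exists>L. \<forall>t\<in>cball t u \<inter> T. L-lipschitz_on (cball x u \<inter> \<Omega>) V" for t
    using u(1) by blast
qed

text \<open>The field is multiplied by a function of the distance to \<open>K\<close> that vanishes
  outside a compact neighbourhood \<open>C\<close> of \<open>K\<close> within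
  \<open>\<Omega>\<close>. Agreement with \<open>V\<close> on an open set around \<open>K\<close>
  gives the room that later open-closed arguments in time require.\<close>

lemma C1_field_lipschitz_extension:
  fixes V :: "'a::euclidean_space \<Rightarrow> 'b::real_normed_vector"
  assumes "open \<Omega>" "compact K" "K \<subseteq> \<Omega>"
    and V: "\<And>p. p \<in> \<Omega> \<Longrightarrow> (V has_derivative D p) (at p)"
    and D: "\<And>v. continuous_on \<Omega> (\<lambda>p. D p v)"
  obtains U W L M where "open U" "K \<subseteq> U" "U \<subseteq> \<Omega>" "L-lipschitz_on UNIV W"
    "\<And>x. norm (W x) \<le> M" "\<And>x. x \<in> U \<Longrightarrow> W x = V x"
proof (cases "K = {}")
  case True
  have "0-lipschitz_on UNIV (\<lambda>_. 0 :: 'b)" by (simp add: lipschitz_on_def)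
  then show ?thesis using True by (intro that[of "{}" 0 "\<lambda>_. 0" 0]) auto
next
  case False
  obtain e where e: "0 < e" and C\<Omega>: "{x. infdist x K \<le> e} \<subseteq> \<Omega>"
    using compact_in_open_separated[OF False assms(2,1,3)] by blast
  define C where "C = {x. infdist x K \<le> e}"
  have "compact C"
    unfolding C_def using False assms(2) e by (intro compact_infdist_le) auto
  have ll: "local_lipschitz {0::real} C (\<lambda>_. V)"
    using C1_imp_local_lipschitz[OF assms(1) V D] local_lipschitz_subset C\<Omega>
    unfolding C_def by (metis subset_refl)
  obtain L where L: "L-lipschitz_on C V"
    using local_lipschitz_compact_implies_lipschitz[OF ll \<open>compact C\<close>] by auto
  have "compact (V ` C)"
    using \<open>compact C\<close> L lipschitz_on_continuous_on by (intro compact_continuous_image) auto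
  then obtain M0 where "\<And>x. x \<in> C \<Longrightarrow> norm (V x) \<le> M0"
    using compact_imp_bounded bounded_iff by (metis imageI)
  define M where "M = max 0 M0"
  have M: "0 \<le> M" "\<And>x. x \<in> C \<Longrightarrow> norm (V x) \<le> M"
    using \<open>\<And>x. x \<in> C \<Longrightarrow> norm (V x) \<le> M0\<close> by (fastforce simp: M_def)+
  \<comment> \<open>Equal to \<open>1\<close> up to distance \<open>e / 2\<close> and to
    \<open>0\<close> from distance \<open>e\<close> on, with slope \<open>2 / e\<close> in
    between.\<close>
  define \<rho> where "\<rho> x = max 0 (min 1 (2 - 2 * infdist x K / e))" for x
  have \<rho>: "0 \<le> \<rho> x" "\<rho> x \<le> 1" for x by (auto simp: \<rho>_def)
  have \<rho>0: "\<rho> x = 0" if "x \<notin> C" for x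
  proof -
    have "2 - 2 * infdist x K / e \<le> 0" using that e by (simp add: C_def field_simps)
    then show ?thesis by (simp add: \<rho>_def)
  qed
  have \<rho>lip: "\<bar>\<rho> x - \<rho> y\<bar> \<le> 2 / e * dist x y" for x y
  proof -
    have "\<bar>\<rho> x - \<rho> y\<bar> \<le> \<bar>2 * infdist x K / e - 2 * infdist y K / e\<bar>"
    proof -
      have "\<bar>max 0 (min 1 (2 - u)) - max 0 (min 1 (2 - v))\<bar> \<le> \<bar>u - v\<bar>" for u v :: real
        by (auto simp: max_def min_def)
      then show ?thesis unfolding \<rho>_def .
    qed
    also have "\<dots> = 2 / e * \<bar>infdist x K - infdist y K\<bar>"
    proof -
      have "2 * infdist x K / e - 2 * infdist y K / e = 2 / e * (infdist x K - infdist y K)"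
        by (simp add: diff_divide_distrib right_diff_distrib)
      then show ?thesis using e by (simp only: abs_mult) simp
    qed
    also have "\<dots> \<le> 2 / e * dist x y"
      using e by (intro mult_left_mono infdist_triangle_abs) auto
    finally show ?thesis .
  qed
  define W where "W x = \<rho> x *\<^sub>R V x" for x
  \<comment> \<open>It is enough that one point lies in \<open>C\<close>: if \<open>y\<close> is
    outside, its cutoff is \<open>0\<close> and no estimate of \<open>V y\<close> occurs. For two
    points outside \<open>C\<close> both values vanish.\<close>
  have half: "norm (W x - W y) \<le> (2 / e * M + L) * dist x y" if "x \<in> C" for x y
  proof (cases "y \<in> C")
    case True
    have "W x - W y = (\<rho> x - \<rho> y) *\<^sub>R V x + \<rho> y *\<^sub>R (V x - V y)"
      by (simp add: W_def algebra_simps)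
    then have "norm (W x - W y) \<le> \<bar>\<rho> x - \<rho> y\<bar> * norm (V x) + \<rho> y * norm (V x - V y)"
      using \<rho> by (metis abs_of_nonneg norm_scaleR norm_triangle_ineq)
    also have "\<dots> \<le> (2 / e * dist x y) * M + 1 * (L * dist x y)"
      using \<rho> \<rho>lip M that True lipschitz_onD[OF L that True] e
      by (intro add_mono mult_mono) (auto simp: dist_norm)
    finally show ?thesis by (simp add: algebra_simps)
  next
    case False
    have "norm (W x - W y) = \<bar>\<rho> x - \<rho> y\<bar> * norm (V x)"
      using \<rho>0[OF False] by (simp add: W_def)
    also have "\<dots> \<le> (2 / e * dist x y) * M"
      using \<rho>lip M that e by (intro mult_mono) auto
    also have "\<dots> \<le> (2 / e * M + L) * dist x y"
      using lipschitz_on_nonneg[OF L] by (simp add: algebra_simps)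
    finally show ?thesis .
  qed
  have "(2 / e * M + L)-lipschitz_on UNIV W"
  proof (rule lipschitz_onI)
    show "0 \<le> 2 / e * M + L" using e M lipschitz_on_nonneg[OF L] by simp
    show "dist (W x) (W y) \<le> (2 / e * M + L) * dist x y" for x y
      using half[of x y] half[of y x] \<rho>0[of x] \<rho>0[of y] \<open>0 \<le> 2 / e * M + L\<close>
      by (cases "x \<in> C"; cases "y \<in> C") (auto simp: dist_norm norm_minus_commute W_def)
  qed
  moreover have "norm (W x) \<le> M" for x
  proof (cases "x \<in> C")
    case True
    then have "\<rho> x * norm (V x) \<le> 1 * M" using \<rho> M by (intro mult_mono) auto
    then show ?thesis using \<rho> by (simp add: W_def)
  qed (use \<rho>0 M in \<open>simp add: W_def\<close>)
  moreover have "W x = V x" if "x \<in> {x. infdist x K < e / 2}" for x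
  proof -
    have "1 \<le> 2 - 2 * infdist x K / e" using that e by (simp add: field_simps)
    then show ?thesis by (simp add: W_def \<rho>_def)
  qed
  moreover have "open {x. infdist x K < e / 2}"
    by (intro open_Collect_less continuous_intros)
  moreover have "{x. infdist x K < e / 2} \<subseteq> \<Omega>" using C\<Omega> e by force
  ultimately show ?thesis using e
    by (intro that[of "{x. infdist x K < e / 2}" "2 / e * M + L" W M]) auto
qed

text \<open>A global flow that follows the vector field only while it stays in \<open>U\<close>.\<close>

definition flow_on :: "'a::real_normed_vector set \<Rightarrow> ('a \<Rightarrow> 'a) \<Rightarrow> ('a \<Rightarrow> real \<Rightarrow> 'a) \<Rightarrow> bool" where
  "flow_on U V \<phi> \<longleftrightarrow> (\<forall>p. \<phi> p 0 = p) \<and> continuous_on UNIV (\<lambda>(p, s). \<phi> p s) \<and>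
     (\<forall>p s. \<phi> p s \<in> U \<longrightarrow> (\<phi> p has_vector_derivative V (\<phi> p s)) (at s)) \<and>
     (\<forall>p s t. \<phi> (\<phi> p s) t = \<phi> p (s + t))"

lemma flow_onD:
  assumes "flow_on U V \<phi>"
  shows "\<phi> p 0 = p" "continuous_on UNIV (\<lambda>(p, s). \<phi> p s)" "continuous_on UNIV (\<phi> p)"
    "\<phi> p s \<in> U \<Longrightarrow> (\<phi> p has_vector_derivative V (\<phi> p s)) (at s)"
    "\<phi> (\<phi> p s) t = \<phi> p (s + t)"
proof -
  show *: "continuous_on UNIV (\<lambda>(p, s). \<phi> p s)" using assms by (simp add: flow_on_def)
  have "continuous_on UNIV (\<lambda>s. (p, s))" by (intro continuous_intros)
  from continuous_on_compose2[OF * this] show "continuous_on UNIV (\<phi> p)" by simp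
qed (use assms in \<open>simp_all add: flow_on_def\<close>)

text \<open>Joint continuity separates into dependence on the starting point, controlled by the
  exponential distance estimate, and continuity in time along one fixed trajectory. The group law is
  uniqueness for an autonomous equation.\<close>

lemma C1_field_flow:
  fixes V :: "'a::euclidean_space \<Rightarrow> 'a"
  assumes "open \<Omega>" "compact K" "K \<subseteq> \<Omega>"
    and "\<And>p. p \<in> \<Omega> \<Longrightarrow> (V has_derivative D p) (at p)"
    and "\<And>v. continuous_on \<Omega> (\<lambda>p. D p v)"
  obtains U \<phi> where "open U" "K \<subseteq> U" "U \<subseteq> \<Omega>" "flow_on U V \<phi>"
proof -
  obtain U W L M where U: "open U" "K \<subseteq> U" "U \<subseteq> \<Omega>" and W: "L-lipschitz_on UNIV W"
    "\<And>x. norm (W x) \<le> M" "\<And>x. x \<in> U \<Longrightarrow> W x = V x"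
    using C1_field_lipschitz_extension[OF assms] by metis
  obtain \<phi> where \<phi>: "\<And>p. \<phi> p 0 = p" "\<And>p s. (\<phi> p has_vector_derivative W (\<phi> p s)) (at s)"
    using lipschitz_ode_solution_exists[OF W(1,2)] by metis
  have cont: "continuous_on UNIV (\<phi> p)" for p
    by (meson \<phi>(2) continuous_at_imp_continuous_on has_vector_derivative_continuous)
  have dist\<phi>: "dist (\<phi> p s) (\<phi> q s) \<le> exp (L * \<bar>s\<bar>) * dist p q" for p q s
    using lipschitz_ode_solutions_dist[OF W(1) \<phi>(2) \<phi>(2), of p s q] by (simp add: \<phi>(1))
  have tend: "((\<lambda>z. \<phi> (fst z) (snd z)) \<longlongrightarrow> \<phi> p s) (at (p, s))" for p s
    unfolding tendsto_dist_iff[of _ "\<phi> p s"]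
  proof (rule Lim_null_comparison)
    have "((\<lambda>z. exp (L * \<bar>snd z\<bar>) * dist (fst z) p + dist (\<phi> p (snd z)) (\<phi> p s)) \<longlongrightarrow>
        exp (L * \<bar>snd (p, s)\<bar>) * dist (fst (p, s)) p + dist (\<phi> p (snd (p, s))) (\<phi> p s)) (at (p, s))"
      by (intro tendsto_intros continuous_on_tendsto_compose[OF cont]) auto
    then show "((\<lambda>z. exp (L * \<bar>snd z\<bar>) * dist (fst z) p + dist (\<phi> p (snd z)) (\<phi> p s)) \<longlongrightarrow> 0) (at (p, s))"
      by simp
    show "\<forall>\<^sub>F z in at (p, s). norm (dist (\<phi> (fst z) (snd z)) (\<phi> p s))
        \<le> exp (L * \<bar>snd z\<bar>) * dist (fst z) p + dist (\<phi> p (snd z)) (\<phi> p s)"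
    proof (intro always_eventually allI)
      fix z :: "'a \<times> real"
      have "dist (\<phi> (fst z) (snd z)) (\<phi> p s)
          \<le> dist (\<phi> (fst z) (snd z)) (\<phi> p (snd z)) + dist (\<phi> p (snd z)) (\<phi> p s)"
        by (rule dist_triangle)
      then show "norm (dist (\<phi> (fst z) (snd z)) (\<phi> p s))
          \<le> exp (L * \<bar>snd z\<bar>) * dist (fst z) p + dist (\<phi> p (snd z)) (\<phi> p s)"
        using dist\<phi>[of "fst z" "snd z" p] by simp
    qed
  qed
  have "continuous_on UNIV (\<lambda>z. \<phi> (fst z) (snd z))"
    by (simp add: continuous_on_def split_paired_all tend)
  moreover have "\<phi> (\<phi> p s) t = \<phi> p (s + t)" for p s t
  proof -
    have "((\<lambda>t. \<phi> p (s + t)) has_vector_derivative W (\<phi> p (s + t))) (at t)" for t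
    proof -
      have "((\<lambda>t. s + t) has_vector_derivative 1) (at t)" by (auto intro!: derivative_eq_intros)
      from vector_diff_chain_at[OF this \<phi>(2)] show ?thesis by (simp add: o_def)
    qed
    from lipschitz_ode_solutions_dist[OF W(1) \<phi>(2) this, of "\<phi> p s" t]
    show ?thesis by (simp add: \<phi>(1))
  qed
  moreover have "(\<phi> p has_vector_derivative V (\<phi> p s)) (at s)" if "\<phi> p s \<in> U" for p s
    using \<phi>(2)[of p s] W(3)[OF that] by simp
  ultimately show ?thesis using U \<phi>(1) by (intro that[of U \<phi>]) (simp_all add: flow_on_def case_prod_unfold)
qed

subsection \<open>First and second derivatives of a \<open>C\<^sup>2\<close> function in the plane\<close>

lemma has_derivative_grad:
  fixes f :: "real^'n \<Rightarrow> real"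
  assumes "f differentiable (at p)"
  shows "(f has_derivative (\<lambda>v. grad f p \<bullet> v)) (at p)"
proof -
  obtain f' where f': "(f has_derivative f') (at p)"
    using assms differentiable_def by blast
  interpret f': bounded_linear f' using f' has_derivative_bounded_linear by blast
  have "partial_deriv i f p = f' (axis i 1)" for i
  proof -
    have "((\<lambda>s. p + s *\<^sub>R axis i 1) has_derivative (\<lambda>s. s *\<^sub>R axis i 1)) (at (0::real))"
      by (auto intro!: derivative_eq_intros)
    from has_derivative_compose[OF this, of f f'] f'
    have "((\<lambda>s. f (p + s *\<^sub>R axis i 1)) has_derivative (\<lambda>s. f' (s *\<^sub>R axis i 1))) (at 0)" by simp
    then have "((\<lambda>s. f (p + s *\<^sub>R axis i 1)) has_real_derivative f' (axis i 1)) (at 0)"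
      unfolding has_field_derivative_def
      by (rule has_derivative_eq_rhs) (auto simp: f'.scaleR mult.commute)
    then show ?thesis by (simp add: partial_deriv_def DERIV_imp_deriv)
  qed
  then have "grad f p \<bullet> v = f' v" for v
  proof -
    have "f' v = f' (\<Sum>i\<in>UNIV. (v $ i) *\<^sub>R axis i 1)"
      by (simp add: basis_expansion flip: scalar_mult_eq_scaleR)
    also have "\<dots> = (\<Sum>i\<in>UNIV. v $ i * f' (axis i 1))" by (simp add: f'.sum f'.scaleR)
    finally show ?thesis
      using \<open>\<And>i. partial_deriv i f p = f' (axis i 1)\<close> by (simp add: grad_def inner_vec_def mult.commute)
  qed
  then have "(\<lambda>v. grad f p \<bullet> v) = f'" by (rule ext)
  then show ?thesis using f' by simp
qed

definition hess :: "(real^'n \<Rightarrow> real) \<Rightarrow> real^'n \<Rightarrow> real^'n \<Rightarrow> real^'n" where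
  "hess f p v = (\<chi> i. grad (partial_deriv i f) p \<bullet> v)"

definition rot90 :: "real^2 \<Rightarrow> real^2" where
  "rot90 v = vector [- v $ 2, v $ 1]"

lemma inner_2: "u \<bullet> v = u $ 1 * v $ 1 + u $ 2 * v $ 2" for u v :: "real^2"
  by (simp add: inner_vec_def sum_2)

lemma vec_eq_2: "u = v \<longleftrightarrow> u $ 1 = v $ 1 \<and> u $ 2 = v $ 2" for u v :: "real^2"
  by (simp add: vec_eq_iff forall_2)

lemma rot90_nth [simp]: "rot90 v $ 1 = - v $ 2" "rot90 v $ 2 = v $ 1"
  by (simp_all add: rot90_def)

lemma linear_rot90: "linear rot90"
  by (rule linearI) (simp_all add: vec_eq_2)

lemma bounded_linear_rot90: "bounded_linear rot90"
  by (simp add: linear_rot90 linear_conv_bounded_linear[symmetric])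

lemma inner_rot90_self [simp]: "v \<bullet> rot90 v = 0" "rot90 v \<bullet> v = 0"
  by (simp_all add: inner_2)

lemma norm_rot90 [simp]: "norm (rot90 v) = norm v"
  by (simp add: norm_eq_sqrt_inner inner_2)

lemma rot90_eq_0_iff [simp]: "rot90 v = 0 \<longleftrightarrow> v = 0"
  by (metis norm_rot90 norm_eq_zero)

lemma orthogonal_2_imp_parallel:
  fixes u v :: "real^2"
  assumes "u \<bullet> v = 0" "u \<noteq> 0"
  obtains c where "v = c *\<^sub>R rot90 u"
proof
  have "u \<bullet> u \<noteq> 0" using assms by simp
  then show "v = ((rot90 u \<bullet> v) / (u \<bullet> u)) *\<^sub>R rot90 u"
    using assms(1) unfolding vec_eq_2 inner_2 rot90_nth vector_scaleR_component
    by (simp add: field_simps) algebra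
qed

section \<open>The vector fields and the integrand attached to \<open>f\<close>\<close>

locale regular_C2_function =
  fixes \<Omega> :: "(real^2) set" and f :: "real^2 \<Rightarrow> real"
  assumes open_domain: "open \<Omega>" and C2: "Ck_on 2 \<Omega> f"
    and grad_nonzero: "p \<in> \<Omega> \<Longrightarrow> grad f p \<noteq> 0"
begin

abbreviation G :: "real^2 \<Rightarrow> real^2" where "G \<equiv> grad f"
abbreviation H :: "real^2 \<Rightarrow> real^2 \<Rightarrow> real^2" where "H \<equiv> hess f"
definition X :: "real^2 \<Rightarrow> real^2" where "X p = rot90 (G p)"
abbreviation level :: "real \<Rightarrow> (real^2) set" where "level t \<equiv> preimage_in \<Omega> f {t}"

lemma f_deriv: "p \<in> \<Omega> \<Longrightarrow> (f has_derivative (\<lambda>v. G p \<bullet> v)) (at p)"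
  using C2 by (intro has_derivative_grad) (simp add: numeral_2_eq_2)

lemma cont_f: "continuous_on \<Omega> f"
  by (meson continuous_at_imp_continuous_on f_deriv has_derivative_continuous)

lemma G_deriv:
  assumes "p \<in> \<Omega>"
  shows "(G has_derivative H p) (at p)"
proof -
  have "(partial_deriv i f has_derivative (\<lambda>v. grad (partial_deriv i f) p \<bullet> v)) (at p)" for i
    using C2 assms by (intro has_derivative_grad) (simp add: numeral_2_eq_2)
  then show ?thesis
    unfolding has_derivative_componentwise_within[of G] by (auto simp: Basis_vec_def hess_def grad_def inner_axis)
qed

lemma cont_G: "continuous_on \<Omega> G"
  by (meson continuous_at_imp_continuous_on G_deriv has_derivative_continuous)

lemma cont_H: "continuous_on \<Omega> (\<lambda>p. H p v)"
proof -
  have "continuous_on \<Omega> (partial_deriv j (partial_deriv i f))" for i j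
    using C2 by (simp add: numeral_2_eq_2)
  then have "continuous_on \<Omega> (grad (partial_deriv i f))" for i
    unfolding grad_def[abs_def] by (intro continuous_on_vec_lambda)
  then show ?thesis unfolding hess_def by (intro continuous_on_vec_lambda continuous_intros)
qed

lemma linear_H: "p \<in> \<Omega> \<Longrightarrow> linear (H p)"
  using G_deriv has_derivative_linear by blast

lemma cont_H_comp:
  assumes "continuous_on S \<gamma>" "\<gamma> ` S \<subseteq> \<Omega>" "continuous_on S w"
  shows "continuous_on S (\<lambda>s. H (\<gamma> s) (w s))"
proof -
  have "H (\<gamma> s) (w s) = (\<Sum>b\<in>Basis. (w s \<bullet> b) *\<^sub>R H (\<gamma> s) b)" if "s \<in> S" for s
  proof -
    interpret linear "H (\<gamma> s)" using assms that by (intro linear_H) auto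
    show ?thesis by (subst euclidean_representation[of "w s", symmetric]) (simp add: sum scale)
  qed
  then show ?thesis
    by (subst continuous_on_cong[OF refl], assumption)
       (intro continuous_intros assms continuous_on_compose2[OF cont_H])
qed

lemma cont_X: "continuous_on \<Omega> X"
  unfolding X_def[abs_def] by (rule bounded_linear.continuous_on[OF bounded_linear_rot90 cont_G])

lemma X_deriv: "p \<in> \<Omega> \<Longrightarrow> (X has_derivative (\<lambda>v. rot90 (H p v))) (at p)"
  unfolding X_def[abs_def] by (rule bounded_linear.has_derivative[OF bounded_linear_rot90 G_deriv])

lemma X_nonzero: "p \<in> \<Omega> \<Longrightarrow> X p \<noteq> 0"
  by (simp add: X_def grad_nonzero)

lemma G_X [simp]: "G p \<bullet> X p = 0"
  by (simp add: X_def)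

lemma unit_tangent_eq: "unit_tangent f p = X p /\<^sub>R norm (X p)"
  by (simp add: unit_tangent_def X_def vec_eq_2 grad_def)

lemma dir_deriv2_eq:
  assumes "p \<in> \<Omega>"
  shows "dir_deriv2 f v p = v \<bullet> H p v"
proof -
  have line: "((\<lambda>s. p + s *\<^sub>R v) has_derivative (\<lambda>s. s *\<^sub>R v)) (at s)" for s
    by (auto intro!: derivative_eq_intros)
  define S where "S = (\<lambda>s. p + s *\<^sub>R v) -` \<Omega>"
  have "open S" unfolding S_def using open_domain by (intro open_vimage continuous_intros)
  have "0 \<in> S" using assms by (simp add: S_def)
  have 1: "deriv (\<lambda>s. f (p + s *\<^sub>R v)) s = G (p + s *\<^sub>R v) \<bullet> v" if "s \<in> S" for s
  proof (rule DERIV_imp_deriv)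
    from that have "p + s *\<^sub>R v \<in> \<Omega>" by (simp add: S_def)
    from has_derivative_compose[OF line f_deriv[OF this]]
    show "((\<lambda>s. f (p + s *\<^sub>R v)) has_real_derivative G (p + s *\<^sub>R v) \<bullet> v) (at s)"
      unfolding has_field_derivative_def by (rule has_derivative_eq_rhs) (auto simp: mult.commute)
  qed
  have "((\<lambda>s. G (p + s *\<^sub>R v) \<bullet> v) has_derivative (\<lambda>s. H p (s *\<^sub>R v) \<bullet> v)) (at 0)"
    using has_derivative_compose[OF line, of G "H p" 0] G_deriv[OF assms]
    by (intro has_derivative_inner_left) simp
  then have "((\<lambda>s. G (p + s *\<^sub>R v) \<bullet> v) has_real_derivative v \<bullet> H p v) (at 0)"
    unfolding has_field_derivative_def
    by (rule has_derivative_eq_rhs) (auto simp: linear_cmul[OF linear_H[OF assms]] inner_commute)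
  \<comment> \<open>The line may leave \<open>\<Omega>\<close>, so the inner derivative is known
    only near \<open>0\<close>; the outer \<open>deriv\<close> depends on nothing else.\<close>
  moreover have "\<forall>\<^sub>F s in nhds 0. deriv (\<lambda>s. f (p + s *\<^sub>R v)) s = G (p + s *\<^sub>R v) \<bullet> v"
    using \<open>open S\<close> \<open>0 \<in> S\<close> 1 eventually_nhds by blast
  then have "deriv (deriv (\<lambda>s. f (p + s *\<^sub>R v))) 0 = deriv (\<lambda>s. G (p + s *\<^sub>R v) \<bullet> v) 0"
    by (rule deriv_cong_ev) simp
  ultimately have "deriv (deriv (\<lambda>s. f (p + s *\<^sub>R v))) 0 = v \<bullet> H p v"
    by (simp add: DERIV_imp_deriv)
  then show ?thesis by (simp add: dir_deriv2_def numeral_2_eq_2)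
qed

abbreviation g :: "real^2 \<Rightarrow> real" where "g p \<equiv> dir_deriv2 f (unit_tangent f p) p"

lemma g_eq:
  assumes "p \<in> \<Omega>"
  shows "g p = (X p \<bullet> H p (X p)) / (X p \<bullet> X p)"
proof -
  have "X p \<bullet> X p = norm (X p) * norm (X p)" by (metis dot_square_norm power2_eq_square)
  then show ?thesis
    using assms by (simp add: dir_deriv2_eq unit_tangent_eq linear_cmul[OF linear_H] divide_inverse)
qed

lemma cont_g: "continuous_on \<Omega> g"
proof -
  have "continuous_on \<Omega> (\<lambda>p. (X p \<bullet> H p (X p)) / (X p \<bullet> X p))"
    by (intro continuous_intros cont_X cont_H_comp) (auto simp: X_nonzero)
  then show ?thesis by (rule continuous_on_eq) (rule g_eq[symmetric])
qed

text \<open>Scaled so that time elapsed along its trajectories is the gain in \<open>f\<close>: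
  passing from level \<open>f p\<close> to level \<open>t\<close> takes time
  \<open>t - f p\<close>.\<close>

definition Y :: "real^2 \<Rightarrow> real^2" where "Y p = inverse (G p \<bullet> G p) *\<^sub>R G p"

lemma G_Y [simp]: "p \<in> \<Omega> \<Longrightarrow> G p \<bullet> Y p = 1"
  by (simp add: Y_def grad_nonzero)

text \<open>The derivative as the product and inverse rules deliver it, written out so that
  continuity in \<open>p\<close> for fixed \<open>v\<close> can be read off term by term.\<close>

definition DY :: "real^2 \<Rightarrow> real^2 \<Rightarrow> real^2" where
  "DY p v = inverse (G p \<bullet> G p) *\<^sub>R H p v +
     (- (inverse (G p \<bullet> G p) * (G p \<bullet> H p v + H p v \<bullet> G p) * inverse (G p \<bullet> G p))) *\<^sub>R G p"

lemma Y_deriv: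
  assumes "p \<in> \<Omega>"
  shows "(Y has_derivative DY p) (at p)"
proof -
  have "G p \<bullet> G p \<noteq> 0" using grad_nonzero[OF assms] by simp
  from has_derivative_scaleR[OF Deriv.has_derivative_inverse[OF this
        has_derivative_inner[OF G_deriv[OF assms] G_deriv[OF assms]]] G_deriv[OF assms]]
  show ?thesis unfolding Y_def[abs_def] DY_def[abs_def] .
qed

lemma cont_DY: "continuous_on \<Omega> (\<lambda>p. DY p v)"
  unfolding DY_def by (intro continuous_intros cont_G cont_H) (auto simp: grad_nonzero)

lemma f_comp_deriv:
  assumes "(\<gamma> has_vector_derivative w) (at s)" "\<gamma> s \<in> \<Omega>"
  shows "((\<lambda>s. f (\<gamma> s)) has_real_derivative G (\<gamma> s) \<bullet> w) (at s)"
  using has_derivative_compose[OF assms(1)[unfolded has_vector_derivative_def] f_deriv[OF assms(2)]]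
  unfolding has_field_derivative_def by (rule has_derivative_eq_rhs) (auto simp: mult.commute)

end

section \<open>Local coordinates: a tangential linear form and the value of \<open>f\<close>\<close>

lemma (in regular_C2_function) local_tangent_direction:
  assumes "q \<in> \<Omega>"
  obtains r where "0 < r" "ball q r \<subseteq> \<Omega>" "\<And>p. p \<in> ball q r \<Longrightarrow> 0 < X q \<bullet> X p"
proof -
  have "continuous (at q) X"
    using cont_X assms open_domain by (simp add: continuous_on_eq_continuous_at)
  then have "((\<lambda>p. X q \<bullet> X p) \<longlongrightarrow> X q \<bullet> X q) (at q)"
    by (intro tendsto_intros) (simp add: continuous_at)
  moreover have "0 < X q \<bullet> X q" using X_nonzero[OF assms] by simp
  ultimately have "\<forall>\<^sub>F p in at q. 0 < X q \<bullet> X p" by (rule order_tendstoD(1))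
  then obtain d where d: "0 < d" "\<And>p. p \<noteq> q \<Longrightarrow> dist p q < d \<Longrightarrow> 0 < X q \<bullet> X p"
    by (auto simp: eventually_at)
  obtain e where e: "0 < e" "ball q e \<subseteq> \<Omega>"
    using open_domain assms open_contains_ball by blast
  show ?thesis
  proof (rule that[of "min d e"])
    show "0 < X q \<bullet> X p" if "p \<in> ball q (min d e)" for p
      using d(2)[of p] that \<open>0 < X q \<bullet> X q\<close> by (cases "p = q") (auto simp: dist_commute)
  qed (use d e in auto)
qed

text \<open>Points with the same value of the linear form \<open>e\<close> differ by a multiple of
  \<open>rot90 e\<close>, and the derivative of \<open>f\<close> in that direction is
  \<open>- (e \<bullet> X x)\<close>, which does not vanish on \<open>U\<close>. Convexity keeps the
  segment in \<open>U\<close>, so the mean value theorem makes the multiple zero. Small balls about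
  \<open>q\<close> with \<open>e = X q\<close> satisfy the hypothesis.\<close>

lemma (in regular_C2_function) chart_inj:
  assumes "convex U" "U \<subseteq> \<Omega>" and pos: "\<And>p. p \<in> U \<Longrightarrow> 0 < e \<bullet> X p"
    and p: "p \<in> U" "p' \<in> U" "e \<bullet> p = e \<bullet> p'" "f p = f p'"
  shows "p = p'"
proof -
  have "e \<noteq> 0" using pos[OF p(1)] by auto
  moreover have "e \<bullet> (p' - p) = 0" using p by (simp add: inner_diff_right)
  ultimately obtain c where c: "p' - p = c *\<^sub>R rot90 e"
    using orthogonal_2_imp_parallel by metis
  define \<phi> where "\<phi> s = f (p + s *\<^sub>R (p' - p))" for s
  have U: "p + s *\<^sub>R (p' - p) \<in> U" if "0 \<le> s" "s \<le> 1" for s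
    using convexD_alt[OF \<open>convex U\<close> p(1,2) that] by (simp add: algebra_simps)
  have "\<exists>z. 0 < z \<and> z < 1 \<and> \<phi> 1 - \<phi> 0 = (1 - 0) * (G (p + z *\<^sub>R (p' - p)) \<bullet> (p' - p))"
  proof (rule MVT2)
    fix s :: real assume "0 \<le> s" "s \<le> 1"
    then have "p + s *\<^sub>R (p' - p) \<in> \<Omega>" using U assms(2) by blast
    moreover have "((\<lambda>s. p + s *\<^sub>R (p' - p)) has_vector_derivative p' - p) (at s)"
      by (auto intro!: derivative_eq_intros)
    ultimately show "(\<phi> has_real_derivative G (p + s *\<^sub>R (p' - p)) \<bullet> (p' - p)) (at s)"
      unfolding \<phi>_def by (rule f_comp_deriv[rotated])
  qed simp
  then obtain z where z: "0 < z" "z < 1" "G (p + z *\<^sub>R (p' - p)) \<bullet> (p' - p) = 0"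
    using p(4) by (auto simp: \<phi>_def)
  have "G x \<bullet> rot90 e = - (e \<bullet> X x)" for x by (simp add: X_def inner_2)
  then have "c * (e \<bullet> X (p + z *\<^sub>R (p' - p))) = 0"
    using z(3) unfolding c by simp
  then have "c = 0" using pos[OF U[of z]] z by simp
  then show ?thesis using c by simp
qed

section \<open>Trajectories in the annulus and connectedness of the level sets\<close>

locale level_annulus = regular_C2_function +
  fixes a b :: real
  assumes a_less_b: "a < b" and a_value: "a \<in> f ` \<Omega>"
    and connected_annulus: "connected (preimage_in \<Omega> f {a..b})"
    and compact_annulus: "compact (preimage_in \<Omega> f {a..b})"
begin

abbreviation K where "K \<equiv> preimage_in \<Omega> f {a..b}"

lemma K_iff: "p \<in> K \<longleftrightarrow> p \<in> \<Omega> \<and> a \<le> f p \<and> f p \<le> b"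
  by (simp add: preimage_in_def)

lemma level_iff: "p \<in> level t \<longleftrightarrow> p \<in> \<Omega> \<and> f p = t"
  by (simp add: preimage_in_def)

lemma level_subset_K: "t \<in> {a..b} \<Longrightarrow> level t \<subseteq> K"
  by (auto simp: preimage_in_def)

lemma K_subset: "K \<subseteq> \<Omega>"
  by (auto simp: preimage_in_def)

lemma compact_level:
  assumes "t \<in> {a..b}"
  shows "compact (level t)"
proof -
  have "continuous_on K f" using cont_f K_subset continuous_on_subset by blast
  then have "closedin (top_of_set K) (K \<inter> f -` {t})"
    by (intro continuous_closedin_preimage) auto
  moreover have "K \<inter> f -` {t} = level t" using assms by (auto simp: preimage_in_def)
  ultimately show ?thesis using closedin_compact compact_annulus by metis
qed

text \<open>An open-closed argument in time. The times at which the trajectory is in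
  \<open>K\<close> with the predicted value of \<open>f\<close> form a closed set because
  \<open>K\<close> is compact. Near such a time the trajectory is in \<open>U\<close>, where
  \<open>f (\<gamma> s) - c * s\<close> has derivative zero, so the set is also open relative to the
  times whose predicted value lies in \<open>{a..b}\<close>. The field \<open>Y\<close> has
  \<open>c = 1\<close>, the field \<open>X\<close> has \<open>c = 0\<close>.\<close>

lemma trajectory_in_K:
  assumes "open U" "K \<subseteq> U" "U \<subseteq> \<Omega>" and cont: "continuous_on UNIV \<gamma>"
    and \<gamma>: "\<And>s. \<gamma> s \<in> U \<Longrightarrow> (\<gamma> has_vector_derivative w s) (at s)"
    and w: "\<And>s. \<gamma> s \<in> U \<Longrightarrow> G (\<gamma> s) \<bullet> w s = c"
    and "\<gamma> 0 \<in> K" and s: "f (\<gamma> 0) + c * s \<in> {a..b}"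
  shows "\<gamma> s \<in> K \<and> f (\<gamma> s) = f (\<gamma> 0) + c * s"
proof -
  define I where "I = {s. f (\<gamma> 0) + c * s \<in> {a..b}}"
  define Z where "Z = {s. \<gamma> s \<in> K \<and> f (\<gamma> s) = f (\<gamma> 0) + c * s}"
  have "convex ((\<lambda>s. c * s) -` {a - f (\<gamma> 0)..b - f (\<gamma> 0)})"
    by (rule convex_linear_vimage) (auto simp: linear_iff algebra_simps)
  also have "(\<lambda>s. c * s) -` {a - f (\<gamma> 0)..b - f (\<gamma> 0)} = I" by (auto simp: I_def)
  finally have "connected I" by (rule convex_connected)
  have "closed Z"
  proof -
    have K1: "closed (\<gamma> -` K)" using cont compact_annulus by (intro closed_vimage compact_imp_closed)
    have "continuous_on (\<gamma> -` K) (\<lambda>s. f (\<gamma> s) - f (\<gamma> 0) - c * s)"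
      using K_subset cont
      by (intro continuous_intros continuous_on_compose2[OF cont_f]) (auto intro: continuous_on_subset)
    then have "closed ((\<gamma> -` K) \<inter> (\<lambda>s. f (\<gamma> s) - f (\<gamma> 0) - c * s) -` {0})"
      using K1 by (intro continuous_closed_preimage) auto
    also have "(\<gamma> -` K) \<inter> (\<lambda>s. f (\<gamma> s) - f (\<gamma> 0) - c * s) -` {0} = Z" by (auto simp: Z_def)
    finally show ?thesis .
  qed
  then have "closedin (top_of_set I) (I \<inter> Z)" by (simp add: closedin_closed_Int)
  moreover have "openin (top_of_set I) (I \<inter> Z)"
  proof (subst openin_subopen, intro ballI)
    fix s assume "s \<in> I \<inter> Z"
    then have "\<gamma> s \<in> U" "f (\<gamma> s) = f (\<gamma> 0) + c * s" using assms(2) by (auto simp: Z_def)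
    moreover have "open (\<gamma> -` U)" using cont assms(1) open_vimage by blast
    ultimately obtain e where e: "0 < e" "ball s e \<subseteq> \<gamma> -` U"
      using open_contains_ball by (metis vimageI)
    have "((\<lambda>s. f (\<gamma> s) - c * s) has_real_derivative 0) (at s' within ball s e)" if "s' \<in> ball s e" for s'
    proof -
      have "\<gamma> s' \<in> U" using that e by auto
      then have "((\<lambda>s. f (\<gamma> s)) has_real_derivative c) (at s')"
        using f_comp_deriv[OF \<gamma>, of s'] w[of s'] assms(3) by auto
      then have "((\<lambda>s. f (\<gamma> s) - c * s) has_real_derivative 0) (at s')"
        by (auto intro!: derivative_eq_intros)
      then show ?thesis by (rule has_field_derivative_at_within)
    qed
    then have "\<exists>k. \<forall>s'\<in>ball s e. f (\<gamma> s') - c * s' = k"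
      by (rule has_field_derivative_zero_constant[OF convex_ball])
    then obtain k where k: "\<And>s'. s' \<in> ball s e \<Longrightarrow> f (\<gamma> s') - c * s' = k" by blast
    have "f (\<gamma> s') = f (\<gamma> 0) + c * s'" if "s' \<in> ball s e" for s'
      using k[OF that] k[of s] e(1) \<open>f (\<gamma> s) = _\<close> by simp
    then have "I \<inter> ball s e \<subseteq> I \<inter> Z"
      using e(2) assms(3) unfolding I_def Z_def K_iff by auto
    then show "\<exists>T. openin (top_of_set I) T \<and> s \<in> T \<and> T \<subseteq> I \<inter> Z"
      using \<open>s \<in> I \<inter> Z\<close> e(1) by (intro exI[of _ "I \<inter> ball s e"]) (auto simp: openin_open)
  qed
  moreover have "0 \<in> I \<inter> Z" using assms(7) by (auto simp: I_def Z_def K_iff)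
  ultimately have "I \<inter> Z = I"
    using \<open>connected I\<close> by (metis connected_clopen empty_iff)
  then show ?thesis using s by (auto simp: I_def Z_def)
qed

text \<open>Joint continuity serves two purposes. With \<open>t\<close> fixed, the level set becomes
  a continuous image of the annulus; with \<open>t = f q\<close> varying, being a lowest point
  becomes a closed condition on \<open>q\<close>.\<close>

lemma level_retraction:
  obtains r where "\<forall>p\<in>K. \<forall>t\<in>{a..b}. r p t \<in> level t" "\<forall>p. r p (f p) = p"
    "continuous_on (K \<times> {a..b}) (\<lambda>(p, t). r p t)"
proof -
  obtain U \<phi> where U: "open U" "K \<subseteq> U" "U \<subseteq> \<Omega>" and flow: "flow_on U Y \<phi>"
    by (rule C1_field_flow[OF open_domain compact_annulus K_subset Y_deriv cont_DY])
  note \<phi> = flow_onD[OF flow]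
  show ?thesis
  proof (rule that[of "\<lambda>p t. \<phi> p (t - f p)"]; (intro ballI allI)?)
    fix p t assume "p \<in> K" "t \<in> {a..b}"
    then have "\<phi> p (t - f p) \<in> K \<and> f (\<phi> p (t - f p)) = f (\<phi> p 0) + 1 * (t - f p)"
      using U by (intro trajectory_in_K[OF U \<phi>(3,4)]) (auto simp: \<phi>(1))
    then show "\<phi> p (t - f p) \<in> level t" by (simp add: \<phi>(1) level_iff K_iff)
  next
    show "\<phi> p (f p - f p) = p" for p by (simp add: \<phi>(1))
    have "continuous_on (K \<times> {a..b}) (\<lambda>z. \<phi> (fst z) (snd z - f (fst z)))"
      using K_subset by (intro continuous_on_compose2[OF \<phi>(2)[unfolded case_prod_unfold], 
              of _ "\<lambda>z. (fst z, snd z - f (fst z))", simplified] continuous_intros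
              continuous_on_compose2[OF cont_f]) auto
    then show "continuous_on (K \<times> {a..b}) (\<lambda>(p, t). \<phi> p (t - f p))" by (simp add: case_prod_unfold)
  qed
qed

lemma K_nonempty: "K \<noteq> {}"
  using a_value a_less_b by (auto simp: preimage_in_def image_iff)

lemma connected_level:
  assumes "t \<in> {a..b}"
  shows "connected (level t)" "level t \<noteq> {}"
proof -
  obtain r where r: "\<forall>p\<in>K. \<forall>t\<in>{a..b}. r p t \<in> level t" "\<forall>p. r p (f p) = p"
    "continuous_on (K \<times> {a..b}) (\<lambda>(p, t). r p t)"
    by (rule level_retraction)
  have "continuous_on K (\<lambda>p. r p t)"
  proof -
    have c: "continuous_on K (\<lambda>p. (p, t))" by (intro continuous_intros)
    have "(\<lambda>p. (p, t)) ` K \<subseteq> K \<times> {a..b}" using assms by blast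
    from continuous_on_compose2[OF r(3) c this] show ?thesis by simp
  qed
  then have "connected ((\<lambda>p. r p t) ` K)"
    using connected_annulus connected_continuous_image by blast
  moreover have "(\<lambda>p. r p t) ` K = level t"
  proof
    show "(\<lambda>p. r p t) ` K \<subseteq> level t" using r(1) assms by auto
    show "level t \<subseteq> (\<lambda>p. r p t) ` K"
    proof
      fix p assume p: "p \<in> level t"
      then have "r p t = p" using r(2) by (auto simp: level_iff)
      then show "p \<in> (\<lambda>p. r p t) ` K"
        using p level_subset_K[OF assms] by (metis image_eqI subsetD)
    qed
  qed
  ultimately show "connected (level t)" "level t \<noteq> {}" using K_nonempty by auto
qed

end

section \<open>Each level set is one periodic orbit\<close>

context level_annulus
begin

text \<open>The linear form \<open>X q\<close> has positive derivative along the orbit while the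
  orbit stays near \<open>q\<close>. This serves both to fill a neighbourhood of \<open>q\<close> in
  the level set and to exclude arbitrarily small periods.\<close>

lemma orbit_locally_chart:
  assumes q: "q \<in> \<Omega>" and \<gamma>: "\<And>s. \<gamma> s \<in> level t" "\<And>s. (\<gamma> has_vector_derivative X (\<gamma> s)) (at s)"
    and "\<gamma> s0 = q"
  obtains e r where "0 < e" "0 < r" "ball q r \<subseteq> \<Omega>" "\<forall>p\<in>ball q r. 0 < X q \<bullet> X p"
    "\<forall>s\<in>{s0-e..s0+e}. \<gamma> s \<in> ball q r" "strict_mono_on {s0-e..s0+e} (\<lambda>s. X q \<bullet> \<gamma> s)"
proof -
  obtain r where r: "0 < r" "ball q r \<subseteq> \<Omega>" "\<And>p. p \<in> ball q r \<Longrightarrow> 0 < X q \<bullet> X p"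
    using local_tangent_direction[OF q] by metis
  have "continuous (at s0) \<gamma>" using \<gamma>(2) has_vector_derivative_continuous by blast
  then obtain d where d: "0 < d" "\<And>s. dist s s0 < d \<Longrightarrow> dist (\<gamma> s) (\<gamma> s0) < r"
    unfolding continuous_at_eps_delta using r(1) by blast
  have near: "\<gamma> s \<in> ball q r" if "s \<in> {s0-d/2..s0+d/2}" for s
    using d(2)[of s] that d(1) \<open>\<gamma> s0 = q\<close> by (auto simp: dist_real_def dist_commute)
  have D: "((\<lambda>s. X q \<bullet> \<gamma> s) has_real_derivative X q \<bullet> X (\<gamma> s)) (at s)" for s
    using bounded_linear.has_vector_derivative[OF bounded_linear_inner_right \<gamma>(2)]
    by (simp add: has_real_derivative_iff_has_vector_derivative)
  have "X q \<bullet> \<gamma> s < X q \<bullet> \<gamma> s'" if "s \<in> {s0-d/2..s0+d/2}" "s' \<in> {s0-d/2..s0+d/2}" "s < s'" for s s'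
  proof (rule DERIV_pos_imp_increasing[OF \<open>s < s'\<close>])
    fix u assume "s \<le> u" "u \<le> s'"
    then have "0 < X q \<bullet> X (\<gamma> u)" using that near by (intro r(3)) auto
    then show "\<exists>y. ((\<lambda>s. X q \<bullet> \<gamma> s) has_real_derivative y) (at u) \<and> 0 < y" using D by blast
  qed
  then have "strict_mono_on {s0-d/2..s0+d/2} (\<lambda>s. X q \<bullet> \<gamma> s)" by (intro strict_mono_onI) auto
  then show ?thesis using that[of "d/2" r] d r near by auto
qed

text \<open>A point \<open>p\<close> of the level set close to \<open>q\<close> has a tangential
  coordinate between those of two nearby orbit points. The intermediate value theorem yields an
  orbit point with the same coordinate, and \<open>chart_inj\<close> identifies it with
  \<open>p\<close>.\<close>

lemma orbit_open:
  assumes \<gamma>: "\<And>s. \<gamma> s \<in> level t" "\<And>s. (\<gamma> has_vector_derivative X (\<gamma> s)) (at s)" and "open I"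
  shows "openin (top_of_set (level t)) (\<gamma> ` I)"
proof (subst openin_subopen, intro ballI)
  fix q assume "q \<in> \<gamma> ` I"
  then obtain s0 where s0: "s0 \<in> I" "\<gamma> s0 = q" by blast
  have "q \<in> \<Omega>" using \<gamma>(1)[of s0] s0 by (simp add: level_iff)
  from orbit_locally_chart[OF this \<gamma> s0(2)]
  obtain e r where e: "0 < e" "0 < r" "ball q r \<subseteq> \<Omega>" "\<forall>p\<in>ball q r. 0 < X q \<bullet> X p"
    "\<forall>s\<in>{s0-e..s0+e}. \<gamma> s \<in> ball q r" "strict_mono_on {s0-e..s0+e} (\<lambda>s. X q \<bullet> \<gamma> s)" by metis
  obtain d where d: "0 < d" "ball s0 d \<subseteq> I" using \<open>open I\<close> s0(1) open_contains_ball by blast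
  define c where "c = min (d/2) e"
  have c: "0 < c" "c \<le> e" "c < d" using d e by (auto simp: c_def)
  define N where "N = ball q r \<inter> {p. X q \<bullet> \<gamma> (s0 - c) < X q \<bullet> p \<and> X q \<bullet> p < X q \<bullet> \<gamma> (s0 + c)}"
  have "open N" unfolding N_def
    by (intro open_Int open_ball open_Collect_conj open_Collect_less continuous_intros)
  moreover have "q \<in> N"
    using strict_mono_onD[OF e(6), of "s0 - c" s0] strict_mono_onD[OF e(6), of s0 "s0 + c"] c e(1,2) s0(2)
    by (auto simp: N_def)
  moreover have "level t \<inter> N \<subseteq> \<gamma> ` I"
  proof
    fix p assume p: "p \<in> level t \<inter> N"
    have "continuous_on {s0 - c..s0 + c} (\<lambda>s. X q \<bullet> \<gamma> s)"
      using \<gamma>(2) has_vector_derivative_continuous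
      by (intro continuous_intros continuous_at_imp_continuous_on) blast
    then obtain s where s: "s0 - c \<le> s" "s \<le> s0 + c" "X q \<bullet> \<gamma> s = X q \<bullet> p"
      using IVT'[of "\<lambda>s. X q \<bullet> \<gamma> s" "s0 - c" "X q \<bullet> p" "s0 + c"] p c by (auto simp: N_def)
    have "\<gamma> s = p"
    proof (rule chart_inj[of "ball q r" "X q"])
      show "\<gamma> s \<in> ball q r" using s c e(5) by auto
      show "f (\<gamma> s) = f p" using p \<gamma>(1)[of s] by (simp add: level_iff)
    qed (use e p s in \<open>auto simp: N_def\<close>)
    moreover have "s \<in> I" using d(2) s c by (auto simp: subset_iff dist_real_def)
    ultimately show "p \<in> \<gamma> ` I" by blast
  qed
  ultimately show "\<exists>T. openin (top_of_set (level t)) T \<and> q \<in> T \<and> T \<subseteq> \<gamma> ` I"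
    using \<gamma>(1)[of s0] s0(2) by (intro exI[of _ "level t \<inter> N"]) (auto simp: openin_open_Int)
qed

lemma level_flow:
  assumes "t \<in> {a..b}"
  obtains \<psi> where "\<forall>p\<in>level t. \<forall>s. \<psi> p s \<in> level t" "\<forall>p. \<psi> p 0 = p"
    "\<forall>p\<in>level t. \<forall>s. (\<psi> p has_vector_derivative X (\<psi> p s)) (at s)"
    "\<forall>p s u. \<psi> (\<psi> p s) u = \<psi> p (s + u)"
proof -
  have c: "continuous_on \<Omega> (\<lambda>p. rot90 (H p v))" for v
    by (rule bounded_linear.continuous_on[OF bounded_linear_rot90 cont_H])
  obtain U \<psi> where U: "open U" "K \<subseteq> U" "U \<subseteq> \<Omega>" and flow: "flow_on U X \<psi>"
    by (rule C1_field_flow[OF open_domain compact_annulus K_subset X_deriv c])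
  note \<psi> = flow_onD[OF flow]
  have in_K: "\<psi> p s \<in> K \<and> f (\<psi> p s) = f (\<psi> p 0) + 0 * s" if "p \<in> level t" for p s
    using that assms level_subset_K[OF assms]
    by (intro trajectory_in_K[OF U \<psi>(3,4)]) (auto simp: \<psi>(1) level_iff)
  show ?thesis
  proof (rule that[of \<psi>])
    show "\<forall>p\<in>level t. \<forall>s. \<psi> p s \<in> level t"
      using in_K by (auto simp: level_iff K_iff \<psi>(1))
    show "\<forall>p\<in>level t. \<forall>s. (\<psi> p has_vector_derivative X (\<psi> p s)) (at s)"
      using in_K U(2) \<psi>(4) by blast
  qed (use \<psi>(1,5) in auto)
qed

text \<open>Injectivity on the half-open interval makes \<open>P\<close> the least period, so every
  point of the level set is visited exactly once. The starting point is left free, because Hopf's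
  theorem will ask for a lowest one.\<close>

definition level_param :: "real \<Rightarrow> (real \<Rightarrow> real^2) \<Rightarrow> real \<Rightarrow> bool" where
  "level_param t \<gamma> P \<longleftrightarrow> 0 < P \<and> (\<forall>s. \<gamma> s \<in> level t) \<and> (\<forall>s. (\<gamma> has_vector_derivative X (\<gamma> s)) (at s)) \<and>
     (\<forall>s. \<gamma> (s + P) = \<gamma> s) \<and> inj_on \<gamma> {0..<P} \<and> \<gamma> ` {0..<P} = level t"

text \<open>The orbits are relatively open and partition the connected level set, so there is only
  one. Compactness forces it to return, strict monotonicity in a chart bounds the periods away from
  \<open>0\<close>, and their infimum is the least period.\<close>

lemma level_param_exists:
  assumes t: "t \<in> {a..b}" and q: "q \<in> level t"
  obtains \<gamma> P where "level_param t \<gamma> P" "\<gamma> 0 = q"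
proof -
  obtain \<psi> where \<psi>: "\<forall>p\<in>level t. \<forall>s. \<psi> p s \<in> level t" "\<forall>p. \<psi> p 0 = p"
    "\<forall>p\<in>level t. \<forall>s. (\<psi> p has_vector_derivative X (\<psi> p s)) (at s)"
    "\<forall>p s u. \<psi> (\<psi> p s) u = \<psi> p (s + u)"
    by (rule level_flow[OF t])
  have opn: "openin (top_of_set (level t)) (\<psi> p ` I)" if "p \<in> level t" "open I" for p I
    using that \<psi> by (intro orbit_open) auto
  define \<gamma> where "\<gamma> = \<psi> q"
  have \<gamma>0: "\<gamma> 0 = q" using \<psi>(2) by (simp add: \<gamma>_def)
  have \<gamma>1: "\<gamma> s \<in> level t" and \<gamma>d: "(\<gamma> has_vector_derivative X (\<gamma> s)) (at s)" for s
    using \<psi>(1,3) q by (auto simp: \<gamma>_def)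
  have shift: "\<gamma> (s + u) = \<gamma> (s' + u)" if "\<gamma> s = \<gamma> s'" for s s' u
    using \<psi>(4) that by (metis \<gamma>_def)
  have range: "range \<gamma> = level t"
  proof -
    have opn_range: "openin (top_of_set (level t)) (range \<gamma>)" using opn[OF q] by (simp add: \<gamma>_def)
    have "level t - range \<gamma> = (\<Union>p\<in>level t - range \<gamma>. range (\<psi> p))"
    proof (intro equalityI subsetI)
      fix p assume "p \<in> level t - range \<gamma>"
      then show "p \<in> (\<Union>p\<in>level t - range \<gamma>. range (\<psi> p))"
        using \<psi>(2) by (intro UN_I[of p] range_eqI[of _ _ 0]) auto
    next
      fix x assume "x \<in> (\<Union>p\<in>level t - range \<gamma>. range (\<psi> p))"
      then obtain p s where p: "p \<in> level t" "p \<notin> range \<gamma>" "x = \<psi> p s" by blast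
      have "x \<notin> range \<gamma>"
      proof
        assume "x \<in> range \<gamma>"
        then obtain u where "\<psi> p s = \<psi> q u" using p(3) by (auto simp: \<gamma>_def)
        then have "\<psi> p (s + - s) = \<psi> q (u + - s)" using \<psi>(4) by metis
        then show False using p(2) \<psi>(2) by (auto simp: \<gamma>_def)
      qed
      then show "x \<in> level t - range \<gamma>" using p \<psi>(1) by auto
    qed
    moreover have "openin (top_of_set (level t)) (\<Union>p\<in>level t - range \<gamma>. range (\<psi> p))"
      by (rule openin_Union) (use opn[OF _ open_UNIV] in auto)
    ultimately have "openin (top_of_set (level t)) (level t - range \<gamma>)" by simp
    then have "closedin (top_of_set (level t)) (range \<gamma>)"
      using \<gamma>1 by (auto simp: closedin_def)
    then show ?thesis
      using connected_level(1)[OF t] opn_range unfolding connected_clopen by blast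
  qed
  \<comment> \<open>The arcs over \<open>{- n<..<n}\<close> are relatively open and exhaust the
    level set, so finitely many cover it. For \<open>n\<close> at least as large as all their
    indices, \<open>\<gamma> n\<close> is already attained at an earlier time, and
    \<open>shift\<close> turns this coincidence into a period.\<close>
  have ex: "\<exists>d>0. \<gamma> d = \<gamma> 0"
  proof -
    have "\<exists>T. open T \<and> \<gamma> ` {- real n<..<real n} = level t \<inter> T" for n
      using opn[OF q, of "{- real n<..<real n}"] by (auto simp: openin_open \<gamma>_def)
    then obtain T where T: "\<And>n. open (T n)" "\<And>n. \<gamma> ` {- real n<..<real n} = level t \<inter> T n" by metis
    have "level t \<subseteq> (\<Union>n. T n)"
    proof
      fix p assume p: "p \<in> level t"
      then obtain s where "p = \<gamma> s" using range by blast
      obtain n where "\<bar>s\<bar> < real n" using reals_Archimedean2 by blast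
      then have "s \<in> {- real n<..<real n}" by auto
      then have "p \<in> \<gamma> ` {- real n<..<real n}" using \<open>p = \<gamma> s\<close> by blast
      then show "p \<in> (\<Union>n. T n)" using T(2) by blast
    qed
    then obtain F where F: "finite F" "level t \<subseteq> (\<Union>n\<in>F. T n)"
      using compactE_image[OF compact_level[OF t], of UNIV T] T(1) by auto
    define n where "n = Max (insert 0 F)"
    have "\<gamma> (real n) \<in> (\<Union>m\<in>F. T m)" using F \<gamma>1 by blast
    then obtain m where m: "m \<in> F" "\<gamma> (real n) \<in> T m" by blast
    then have "\<gamma> (real n) \<in> \<gamma> ` {- real m<..<real m}" using T(2) \<gamma>1 by blast
    then obtain s where s: "s < real m" "\<gamma> (real n) = \<gamma> s" by auto
    have "m \<le> n" using m F by (simp add: n_def)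
    then have "0 < real n - s" using s(1) by linarith
    moreover have "\<gamma> (real n + - s) = \<gamma> (s + - s)" by (rule shift[OF s(2)])
    ultimately show ?thesis by (intro exI[of _ "real n - s"]) simp
  qed
  define D where "D = {d. 0 < d \<and> \<gamma> d = \<gamma> 0}"
  define P where "P = Inf D"
  have D: "D \<noteq> {}" "bdd_below D" using ex by (auto simp: D_def intro!: bdd_belowI[of _ 0])
  have "q \<in> \<Omega>" using q by (simp add: level_iff)
  from orbit_locally_chart[OF this \<gamma>1 \<gamma>d \<gamma>0]
  obtain e r where e: "0 < e" and mono: "strict_mono_on {0-e..0+e} (\<lambda>s. X q \<bullet> \<gamma> s)" by metis
  have "e \<le> d" if "d \<in> D" for d
  proof (rule ccontr)
    assume "\<not> e \<le> d"
    then have "X q \<bullet> \<gamma> 0 < X q \<bullet> \<gamma> d"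
      using that e by (intro strict_mono_onD[OF mono]) (auto simp: D_def)
    then show False using that by (simp add: D_def)
  qed
  then have "0 < P" using e D unfolding P_def by (meson cInf_greatest less_le_trans)
  have contg: "continuous_on UNIV \<gamma>"
    by (meson \<gamma>d continuous_at_imp_continuous_on has_vector_derivative_continuous)
  have "P \<in> D"
  proof -
    have "P \<in> closure D" unfolding P_def by (rule closure_contains_Inf[OF D])
    moreover have "closed {d. \<gamma> d = \<gamma> 0}"
      using contg by (intro closed_Collect_eq) (auto intro!: continuous_intros)
    ultimately have "\<gamma> P = \<gamma> 0"
      using closure_minimal[of D "{d. \<gamma> d = \<gamma> 0}"] by (auto simp: D_def)
    then show ?thesis using \<open>0 < P\<close> by (simp add: D_def)
  qed
  then have per: "\<gamma> (s + P) = \<gamma> s" for s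
    using shift[of P 0 s] by (simp add: D_def add.commute)
  have per_nat: "\<gamma> (s + real n * P) = \<gamma> s" for s n
  proof (induction n)
    case (Suc n)
    have "\<gamma> (s + real (Suc n) * P) = \<gamma> ((s + real n * P) + P)" by (simp add: algebra_simps)
    then show ?case using per Suc by simp
  qed simp
  have per_int: "\<gamma> (s + of_int k * P) = \<gamma> s" for s k
  proof (cases "0 \<le> k")
    case True
    then show ?thesis using per_nat[of s "nat k"] by simp
  next
    case False
    then show ?thesis using per_nat[of "s + of_int k * P" "nat (- k)"] by simp
  qed
  have "inj_on \<gamma> {0..<P}"
  proof (rule linorder_inj_onI')
    fix s u assume su: "s \<in> {0..<P}" "u \<in> {0..<P}" "s < u"
    show "\<gamma> s \<noteq> \<gamma> u"
    proof
      assume "\<gamma> s = \<gamma> u"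
      then have "\<gamma> (u - s) = \<gamma> 0" using shift[of u s "- s"] by simp
      then have "u - s \<in> D" using su by (simp add: D_def)
      then have "P \<le> u - s" unfolding P_def using D by (intro cInf_lower)
      then show False using su by simp
    qed
  qed
  moreover have "\<gamma> ` {0..<P} = level t"
  proof
    show "\<gamma> ` {0..<P} \<subseteq> level t" using \<gamma>1 by blast
    show "level t \<subseteq> \<gamma> ` {0..<P}"
    proof
      fix p assume "p \<in> level t"
      then obtain s where s: "p = \<gamma> s" using range by blast
      define k where "k = \<lfloor>s / P\<rfloor>"
      have "of_int k * P \<le> s" "s < (of_int k + 1) * P"
        unfolding k_def using \<open>0 < P\<close> by (rule floor_divide_lower, rule floor_divide_upper)
      then have "s + of_int (- k) * P \<in> {0..<P}" by (auto simp: algebra_simps)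
      moreover have "p = \<gamma> (s + of_int (- k) * P)" using s per_int by metis
      ultimately show "p \<in> \<gamma> ` {0..<P}" by blast
    qed
  qed
  ultimately have "level_param t \<gamma> P"
    unfolding level_param_def using \<open>0 < P\<close> \<gamma>1 \<gamma>d per by auto
  then show ?thesis using that \<gamma>0 by blast
qed

end

subsection \<open>The turning number of a simple closed curve\<close>

text \<open>The values of \<open>h\<close> differ by integer multiples of
  \<open>2 * pi * \<i>\<close>, a discrete set. This is how two continuous lifts of the same
  argument are compared.\<close>

lemma constant_of_exp_constant:
  fixes h :: "'a::topological_space \<Rightarrow> complex"
  assumes "connected S" "continuous_on S h" "\<And>x. x \<in> S \<Longrightarrow> exp (h x) = k" "x \<in> S" "y \<in> S"
  shows "h x = h y"
proof -
  have "h constant_on S"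
  proof (rule continuous_discrete_range_constant[OF assms(1,2)])
    fix x assume "x \<in> S"
    show "\<exists>e>0. \<forall>y. y \<in> S \<and> h y \<noteq> h x \<longrightarrow> e \<le> norm (h y - h x)"
    proof (intro exI[of _ "2 * pi"] conjI allI impI)
      fix y assume y: "y \<in> S \<and> h y \<noteq> h x"
      then have "exp (h y) = exp (h x)" using assms(3) \<open>x \<in> S\<close> by simp
      then obtain n where n: "h y = h x + of_int (2 * n) * of_real pi * \<i>"
        by (auto simp: exp_eq)
      then have "n \<noteq> 0" using y by auto
      then have "1 \<le> \<bar>real_of_int n\<bar>" by linarith
      then have "2 * pi * 1 \<le> 2 * pi * \<bar>real_of_int n\<bar>" by (intro mult_left_mono) auto
      then show "2 * pi \<le> norm (h y - h x)" using n by (simp add: norm_mult)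
    qed simp
  qed
  then show ?thesis using assms(4,5) by (auto simp: constant_on_def)
qed

text \<open>A lift of the argument along a path in the closed upper half plane that ends opposite to
  its start changes by a half turn: compare it with the branch of the logarithm cut along the
  negative imaginary axis.\<close>

lemma half_turn_upper_half_plane:
  fixes g :: "real \<Rightarrow> complex"
  assumes "0 \<le> P" and cont: "continuous_on {0..P} g" and up: "\<And>t. t \<in> {0..P} \<Longrightarrow> 0 \<le> Im (exp (g t))"
    and start: "exp (g 0) = of_real x" and finish: "exp (g P) = of_real y"
    and opposite: "sgn y = - sgn x"
  shows "Im (g P) - Im (g 0) = pi * sgn x"
proof -
  have nn: "- \<i> * exp (g t) \<notin> \<real>\<^sub>\<le>\<^sub>0" if "t \<in> {0..P}" for t
  proof
    assume *: "- \<i> * exp (g t) \<in> \<real>\<^sub>\<le>\<^sub>0"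
    then have "Im (exp (g t)) \<le> 0" "Re (exp (g t)) = 0" by (auto simp: complex_nonpos_Reals_iff)
    then have "exp (g t) = 0" using up[OF that] by (intro complex_eqI) auto
    then show False by simp
  qed
  define h where "h t = g t - Ln (- \<i> * exp (g t))" for t
  have "h 0 = h P"
  proof (rule constant_of_exp_constant[of "{0..P}" h \<i>])
    show "continuous_on {0..P} h" unfolding h_def using nn by (intro continuous_intros cont) auto
    show "exp (h t) = \<i>" if "t \<in> {0..P}" for t
      by (simp add: h_def exp_diff field_simps)
  qed (use \<open>0 \<le> P\<close> in auto)
  moreover have Ln: "Im (Ln (- \<i> * of_real r)) = - (pi / 2) * sgn r" if "r \<noteq> 0" for r :: real
  proof (cases "0 < r")
    case True
    then have "Ln (of_real r * (- \<i>)) = Ln (of_real r) + Ln (- \<i>)"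
      using True pi_gt_zero by (intro Ln_times_simple) (auto simp: Ln_of_real simp del: pi_gt_zero)
    then show ?thesis using True by (simp add: mult.commute Ln_of_real)
  next
    case False
    then have "Ln (of_real (- r) * \<i>) = Ln (of_real (- r)) + Ln \<i>"
      using that pi_gt_zero
      by (intro Ln_times_simple) (auto simp: Ln_of_real simp del: of_real_minus pi_gt_zero)
    then show ?thesis using False that by (simp add: mult.commute Ln_of_real del: of_real_minus) simp
  qed
  moreover have "x \<noteq> 0" "y \<noteq> 0" using start finish by (metis exp_not_eq_zero of_real_0)+
  ultimately show ?thesis
    using Ln[of x] Ln[of y] opposite unfolding h_def start finish
    by (simp add: complex_eq_iff algebra_simps)
qed

text \<open>Hadamard's lemma: the average of \<open>c'\<close> over the segment from
  \<open>s\<close> to \<open>u\<close> is the divided difference, continuous across the diagonal. It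
  is meant for either order of \<open>s\<close> and \<open>u\<close>, since the secant will also be
  formed with \<open>u - P\<close>.\<close>

lemma secant_exists:
  fixes c :: "real \<Rightarrow> complex"
  assumes c: "\<And>s. (c has_vector_derivative c' s) (at s)" and c': "continuous_on UNIV c'"
  obtains Q where "\<forall>s u. c u - c s = of_real (u - s) * Q (s, u)" "continuous_on UNIV Q"
    "\<forall>s. Q (s, s) = c' s"
proof
  define Q where "Q z = integral {0..1} (\<lambda>l. c' (fst z + l * (snd z - fst z)))" for z :: "real \<times> real"
  show "\<forall>s u. c u - c s = of_real (u - s) * Q (s, u)"
  proof (intro allI)
    fix s u
    have "((\<lambda>l. of_real (u - s) * c' (s + l * (u - s))) has_integral
        c (s + 1 * (u - s)) - c (s + 0 * (u - s))) {0..1}"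
    proof (rule fundamental_theorem_of_calculus)
      fix l :: real
      have "((\<lambda>l. s + l * (u - s)) has_vector_derivative (u - s)) (at l within {0..1})"
        by (auto intro!: derivative_eq_intros simp: has_real_derivative_iff_has_vector_derivative[symmetric])
      from vector_diff_chain_within[OF this has_vector_derivative_at_within[OF c]]
      show "((\<lambda>l. c (s + l * (u - s))) has_vector_derivative of_real (u - s) * c' (s + l * (u - s)))
        (at l within {0..1})" by (simp add: o_def scaleR_conv_of_real)
    qed simp
    then have "((\<lambda>l. of_real (u - s) * c' (s + l * (u - s))) has_integral (c u - c s)) {0..1}" by simp
    then have "c u - c s = integral {0..1} (\<lambda>l. of_real (u - s) * c' (s + l * (u - s)))"
      by (rule integral_unique[symmetric])
    then show "c u - c s = of_real (u - s) * Q (s, u)" by (simp only: Q_def fst_conv snd_conv integral_mult_right)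
  qed
  have "continuous_on UNIV (\<lambda>z :: real \<times> real. integral (cbox 0 1) (\<lambda>l. c' (fst z + l * (snd z - fst z))))"
    by (rule integral_continuous_on_param, unfold case_prod_unfold)
       (intro continuous_on_compose2[OF c'] continuous_intros; simp)
  then show "continuous_on UNIV Q" by (simp add: Q_def[abs_def])
  show "\<forall>s. Q (s, s) = c' s" by (simp add: Q_def)
qed

text \<open>Hopf's argument. On the triangle \<open>0 \<le> s \<le> u \<le> P\<close> the normalised secant is a nonvanishing
  continuous function, the tangent direction on the diagonal. Along the two legs, the curve being
  started at a lowest point, the secant stays in a closed half plane.\<close>

theorem turning_number_simple_closed_curve:
  fixes c :: "real \<Rightarrow> complex"
  assumes c: "\<And>s. (c has_vector_derivative c' s) (at s)"
    and c': "\<And>s. (c' has_vector_derivative c'' s) (at s)" and c'': "continuous_on UNIV c''"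
    and "0 < P" and per: "\<And>s. c (s + P) = c s" and inj: "inj_on c {0..<P}"
    and regular: "\<And>s. c' s \<noteq> 0" and low: "\<And>s. Im (c 0) \<le> Im (c s)"
  shows "integral {0..P} (\<lambda>s. Im (c'' s / c' s)) = sgn (Re (c' 0)) * (2 * pi)"
proof -
  have contc': "continuous_on UNIV c'"
    by (meson c' continuous_at_imp_continuous_on has_vector_derivative_continuous)
  have per': "c' (s + P) = c' s" for s
  proof -
    have "((\<lambda>s. s + P) has_vector_derivative 1) (at s)" by (auto intro!: derivative_eq_intros)
    from vector_diff_chain_at[OF this c]
    have "((\<lambda>s. c (s + P)) has_vector_derivative c' (s + P)) (at s)" by (simp add: o_def)
    then have "(c has_vector_derivative c' (s + P)) (at s)" using per by simp
    then show ?thesis using c vector_derivative_unique_at by blast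
  qed
  \<comment> \<open>The height has a minimum at time \<open>0\<close>, so the tangent is horizontal
    there. This makes the values at the three corners of the triangle real.\<close>
  have Im0: "Im (c' 0) = 0"
  proof -
    have "((\<lambda>s. Im (c s)) has_real_derivative Im (c' 0)) (at 0)"
      using bounded_linear.has_vector_derivative[OF bounded_linear_Im c]
      by (simp add: has_real_derivative_iff_has_vector_derivative)
    then show ?thesis using low by (intro DERIV_local_min[of _ _ _ 1]) auto
  qed
  obtain Q where Q: "\<forall>s u. c u - c s = of_real (u - s) * Q (s, u)" and contQ: "continuous_on UNIV Q"
    and Qdiag: "\<forall>s. Q (s, s) = c' s"
    by (rule secant_exists[OF c contc'])
  define T where "T = {z :: real \<times> real. 0 \<le> fst z \<and> fst z \<le> snd z \<and> snd z \<le> P}"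
  have "convex T"
  proof (rule convexI)
    fix z w and u v :: real
    assume zw: "z \<in> T" "w \<in> T" and uv: "0 \<le> u" "0 \<le> v" "u + v = 1"
    have "u * fst z + v * fst w \<le> u * snd z + v * snd w"
      using zw uv by (intro add_mono mult_left_mono) (auto simp: T_def)
    moreover have "u * snd z + v * snd w \<le> u * P + v * P"
      using zw uv by (intro add_mono mult_left_mono) (auto simp: T_def)
    moreover have "u * P + v * P = P" using uv by (metis distrib_right mult_1)
    ultimately show "u *\<^sub>R z + v *\<^sub>R w \<in> T" using zw uv by (simp add: T_def)
  qed
  \<comment> \<open>At the corner \<open>(0, P)\<close> the chord closes up and \<open>Q\<close>
    vanishes. Dividing by \<open>P - (u - s)\<close> as well cancels this zero, with limit
    \<open>- c' 0 / P\<close>, and alters no direction elsewhere.\<close>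
  define \<rho> where "\<rho> z = (if snd z - fst z < P then Q z / of_real (P - (snd z - fst z)) else - c' 0 / of_real P)" for z
  \<comment> \<open>By periodicity the chord from \<open>s\<close> to \<open>u\<close> is also the
    chord from \<open>s\<close> to \<open>u - P\<close>. The secant of that shorter interval gives a
    formula for \<open>\<rho>\<close> that stays regular at the corner.\<close>
  have \<rho>2: "\<rho> z = - Q (fst z, snd z - P) / of_real (snd z - fst z)" if "z \<in> T" "0 < snd z - fst z" for z
  proof (cases "snd z - fst z < P")
    case True
    define d where "d = snd z - fst z"
    have "c (snd z) - c (fst z) = of_real d * Q z"
      using Q[rule_format, of "snd z" "fst z"] by (simp add: d_def)
    moreover have "c (snd z) - c (fst z) = of_real (d - P) * Q (fst z, snd z - P)"
      using Q[rule_format, of "snd z - P" "fst z"] per[of "snd z - P"] by (simp add: d_def algebra_simps)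
    ultimately have "of_real d * Q z = of_real (d - P) * Q (fst z, snd z - P)" by (rule trans[OF sym])
    then have "Q z * of_real d = - Q (fst z, snd z - P) * of_real (P - d)"
      by (simp add: algebra_simps)
    moreover have "(of_real d :: complex) \<noteq> 0" "(of_real (P - d) :: complex) \<noteq> 0"
      using True that(2) unfolding d_def of_real_eq_0_iff by linarith+
    ultimately have "Q z / of_real (P - d) = - Q (fst z, snd z - P) / of_real d"
      by (subst frac_eq_eq)
    then show ?thesis using True unfolding \<rho>_def d_def by simp
  next
    case False
    then have "fst z = 0" "snd z = P" using that by (auto simp: T_def)
    then show ?thesis using Qdiag by (simp add: \<rho>_def)
  qed
  have cont\<rho>: "continuous_on T \<rho>"
    unfolding continuous_on_eq_continuous_within
  proof
    fix z assume z: "z \<in> T"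
    show "continuous (at z within T) \<rho>"
    proof (cases "snd z - fst z < P")
      case True
      have "continuous_on (T \<inter> {z. snd z - fst z < P}) (\<lambda>z. Q z / of_real (P - (snd z - fst z)))"
        by (intro continuous_intros continuous_on_subset[OF contQ])
           (auto simp: simp del: of_real_diff)
      then have "continuous_on (T \<inter> {z. snd z - fst z < P}) \<rho>"
        by (rule continuous_on_eq) (simp add: \<rho>_def)
      moreover have "at z within T = at z within (T \<inter> {z. snd z - fst z < P})"
        using True by (intro at_within_nhd[of z "{z. snd z - fst z < P}"] open_Collect_less continuous_intros) auto
      ultimately show ?thesis using z True by (auto simp: continuous_on_eq_continuous_within)
    next
      case False
      then have pos: "0 < snd z - fst z" using \<open>0 < P\<close> by linarith
      have "continuous_on (T \<inter> {z. 0 < snd z - fst z}) (\<lambda>z. - Q (fst z, snd z - P) / of_real (snd z - fst z))"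
        by (intro continuous_intros continuous_on_compose2[OF contQ]) auto
      then have "continuous_on (T \<inter> {z. 0 < snd z - fst z}) \<rho>"
        by (rule continuous_on_eq) (simp add: \<rho>2)
      moreover have "at z within T = at z within (T \<inter> {z. 0 < snd z - fst z})"
        using pos by (intro at_within_nhd[of z "{z. 0 < snd z - fst z}"] open_Collect_less continuous_intros) auto
      ultimately show ?thesis using z pos by (auto simp: continuous_on_eq_continuous_within)
    qed
  qed
  \<comment> \<open>Chords are nonzero by injectivity, where an endpoint \<open>P\<close> has to be
    replaced by \<open>0\<close>; on the diagonal and at the corner regularity takes over.\<close>
  have nz\<rho>: "\<rho> z \<noteq> 0" if z: "z \<in> T" for z
  proof (cases "snd z - fst z < P")
    case True
    have "Q z \<noteq> 0"
    proof (cases "fst z = snd z")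
      case True
      then have "Q z = c' (fst z)" using Qdiag by (metis prod.collapse)
      then show ?thesis using regular by simp
    next
      case False
      have "c (snd z) \<noteq> c (fst z)"
      proof (cases "snd z = P")
        case True
        then have "c (snd z) = c 0" using per[of 0] by simp
        moreover have "c 0 \<noteq> c (fst z)"
          using True \<open>snd z - fst z < P\<close> z False inj_onD[OF inj, of 0 "fst z"] by (auto simp: T_def)
        ultimately show ?thesis by simp
      next
        case False2: False
        then show ?thesis using z False inj_onD[OF inj, of "snd z" "fst z"] by (auto simp: T_def)
      qed
      then show ?thesis using Q[rule_format, of "snd z" "fst z"] by auto
    qed
    then show ?thesis using True by (simp add: \<rho>_def del: of_real_diff)
  next
    case False
    then show ?thesis using regular \<open>0 < P\<close> by (simp add: \<rho>_def)
  qed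
  \<comment> \<open>The triangle is contractible, so one logarithm exists on all of it, and the
    change along the diagonal is the sum of the changes along the two legs.\<close>
  have "\<exists>g. continuous_on T g \<and> (\<forall>z\<in>T. \<rho> z = exp (g z))"
  proof (rule continuous_logarithm_on_contractible[OF cont\<rho> convex_imp_contractible[OF \<open>convex T\<close>] nz\<rho>])
    fix g :: "real \<times> real \<Rightarrow> complex"
    assume "continuous_on T g" "\<And>z. z \<in> T \<Longrightarrow> \<rho> z = exp (g z)"
    then show ?thesis by blast
  qed
  then obtain g where g: "continuous_on T g" "\<And>z. z \<in> T \<Longrightarrow> \<rho> z = exp (g z)" by blast
  have T: "(0, t) \<in> T" "(t, P) \<in> T" "(t, t) \<in> T" if "t \<in> {0..P}" for t using that by (auto simp: T_def)
  define r where "r = Re (c' 0) / P"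
  have c'0: "c' 0 / of_real P = of_real r" using Im0 by (simp add: r_def complex_eq_iff)
  have corner: "\<rho> (0, 0) = of_real r" "\<rho> (0, P) = - of_real r" "\<rho> (P, P) = of_real r"
    using c'0 per'[of 0] \<open>0 < P\<close> Qdiag by (simp_all add: \<rho>_def)
  have contg: "continuous_on {0..P} (\<lambda>t. g (0, t))" "continuous_on {0..P} (\<lambda>t. g (t, P))"
    "continuous_on {0..P} (\<lambda>t. g (t, t))"
    by (intro continuous_on_compose2[OF g(1)] continuous_intros; use T in auto)+
  have upper: "0 \<le> Im (\<rho> (0, t))" if "t \<in> {0..P}" for t
  proof (cases "t = 0 \<or> t = P")
    case True
    then show ?thesis using corner by auto
  next
    case False
    then have "\<rho> (0, t) = (c t - c 0) / of_real (t * (P - t))"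
      using Q[rule_format, of t 0] that by (simp add: \<rho>_def)
    also have "Im \<dots> = (Im (c t) - Im (c 0)) / (t * (P - t))" by (simp only: Im_divide_of_real minus_complex.simps)
    finally show ?thesis using low[of t] that by simp
  qed
  have lower: "0 \<le> Im (- \<rho> (t, P))" if "t \<in> {0..P}" for t
  proof (cases "t = 0 \<or> t = P")
    case True
    then show ?thesis using corner by auto
  next
    case False
    then have t: "t < P" "t \<noteq> 0" using that by auto
    have e: "c t - c 0 = of_real (P - t) * - Q (t, P)"
      using Q[rule_format, of P t] per[of 0] by (simp add: algebra_simps)
    have "(of_real (P - t) :: complex) \<noteq> 0" using t unfolding of_real_eq_0_iff by linarith
    then have "(c t - c 0) / of_real ((P - t) * t) = - Q (t, P) / of_real t"
      unfolding e of_real_mult by (rule nonzero_mult_divide_mult_cancel_left)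
    then have "- \<rho> (t, P) = (c t - c 0) / of_real ((P - t) * t)"
      using False that by (simp add: \<rho>_def)
    also have "Im \<dots> = (Im (c t) - Im (c 0)) / ((P - t) * t)" by (simp only: Im_divide_of_real minus_complex.simps)
    finally show ?thesis using low[of t] that by simp
  qed
  have leg1: "Im (g (0, P)) - Im (g (0, 0)) = pi * sgn r"
  proof (rule half_turn_upper_half_plane[where y = "- r", OF _ contg(1)])
    have e: "exp (g (0, t)) = \<rho> (0, t)" if "t \<in> {0..P}" for t
      using g(2)[OF T(1)[OF that]] by simp
    show "0 \<le> Im (exp (g (0, t)))" if "t \<in> {0..P}" for t using e[OF that] upper[OF that] by simp
    show "exp (g (0, 0)) = of_real r" "exp (g (0, P)) = of_real (- r)"
      using e[of 0] e[of P] corner \<open>0 < P\<close> by simp_all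
  qed (use \<open>0 < P\<close> in \<open>auto simp: sgn_minus\<close>)
  \<comment> \<open>On this leg it is \<open>- \<rho>\<close> that lies in the closed upper half
    plane. Adding \<open>\<i> * pi\<close> to the logarithm passes to \<open>- \<rho>\<close>
    without changing the increment, and the path again runs from \<open>r\<close> to
    \<open>- r\<close>.\<close>
  have leg2: "Im (g (P, P) + \<i> * pi) - Im (g (0, P) + \<i> * pi) = pi * sgn r"
  proof (rule half_turn_upper_half_plane[where y = "- r" and g = "\<lambda>t. g (t, P) + \<i> * pi"])
    show "continuous_on {0..P} (\<lambda>t. g (t, P) + \<i> * pi)" by (intro continuous_intros contg)
    have e: "exp (g (t, P) + \<i> * pi) = - \<rho> (t, P)" if "t \<in> {0..P}" for t
      using g(2)[OF T(2)[OF that]] by (simp add: exp_add exp_pi_i')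
    show "0 \<le> Im (exp (g (t, P) + \<i> * pi))" if "t \<in> {0..P}" for t using e[OF that] lower[OF that] by simp
    show "exp (g (0, P) + \<i> * pi) = of_real r" "exp (g (P, P) + \<i> * pi) = of_real (- r)"
      using e[of 0] e[of P] corner \<open>0 < P\<close> by simp_all
  qed (use \<open>0 < P\<close> in \<open>auto simp: sgn_minus\<close>)
  have contq: "continuous_on UNIV (\<lambda>s. c'' s / c' s)"
    using regular by (intro continuous_intros c'' contc') auto
  define \<theta> where "\<theta> s = integral {0..s} (\<lambda>s. c'' s / c' s)" for s
  have \<theta>: "(\<theta> has_vector_derivative c'' s / c' s) (at s within {0..P})" if "s \<in> {0..P}" for s
    unfolding \<theta>_def using that continuous_on_subset[OF contq] by (intro integral_has_vector_derivative) auto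
  \<comment> \<open>Constancy of this product says that \<open>\<theta>\<close> is a logarithm of
    \<open>c'\<close> up to a constant, just as \<open>g\<close> is on the diagonal; their
    increments therefore agree.\<close>
  have "((\<lambda>s. c' s * exp (- \<theta> s)) has_vector_derivative 0) (at s within {0..P})" if s: "s \<in> {0..P}" for s
  proof -
    have "((\<lambda>s. exp (- \<theta> s)) has_vector_derivative - (c'' s / c' s) * exp (- \<theta> s)) (at s within {0..P})"
      using field_vector_diff_chain_within[OF has_vector_derivative_minus[OF \<theta>[OF s]], of exp "exp (- \<theta> s)"]
      by (simp add: o_def DERIV_exp has_field_derivative_at_within)
    from has_vector_derivative_mult[OF has_vector_derivative_at_within[OF c'] this]
    show ?thesis using regular[of s] by (simp add: field_simps)
  qed
  then obtain k where k: "\<And>s. s \<in> {0..P} \<Longrightarrow> c' s * exp (- \<theta> s) = k"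
    using has_vector_derivative_zero_constant[of "{0..P}" "\<lambda>s. c' s * exp (- \<theta> s)"] by blast
  have "g (0, 0) - \<theta> 0 = g (P, P) - \<theta> P"
  proof (rule constant_of_exp_constant[of "{0..P}" "\<lambda>s. g (s, s) - \<theta> s" "k / of_real P"])
    show "continuous_on {0..P} (\<lambda>s. g (s, s) - \<theta> s)"
    proof (intro continuous_on_diff contg(3))
      show "continuous_on {0..P} \<theta>"
        unfolding \<theta>_def using continuous_on_subset[OF contq]
        by (intro indefinite_integral_continuous_1 integrable_continuous_interval) auto
    qed
    fix s assume s: "s \<in> {0..P}"
    have "exp (g (s, s)) = c' s / of_real P"
      using g(2)[OF T(3)[OF s]] Qdiag \<open>0 < P\<close> by (simp add: \<rho>_def)
    then show "exp (g (s, s) - \<theta> s) = k / of_real P"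
      using k[OF s] by (simp add: exp_diff exp_minus field_simps)
  qed (use \<open>0 < P\<close> in auto)
  then have "\<theta> P = g (P, P) - g (0, 0)" by (simp add: \<theta>_def algebra_simps)
  then have "Im (\<theta> P) = 2 * pi * sgn r" using leg1 leg2 by simp
  moreover have "integral {0..P} (\<lambda>s. Im (c'' s / c' s)) = Im (\<theta> P)"
    unfolding \<theta>_def using continuous_on_subset[OF contq] 
    by (intro integral_linear[OF integrable_continuous_interval bounded_linear_Im, unfolded o_def]) auto
  moreover have "sgn r = sgn (Re (c' 0))" using \<open>0 < P\<close> by (simp add: r_def sgn_divide)
  ultimately show ?thesis by simp
qed

subsection \<open>The two sides of a level curve\<close>

text \<open>By the Jordan-Brouwer theorem \<open>S\<close> is the frontier of every component of its
  complement, and the complement is disconnected. Hence both the outside and some component of the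
  inside come arbitrarily close to \<open>q\<close>.\<close>

lemma Jordan_curve_both_sides:
  fixes S :: "(real^2) set"
  assumes hom: "S homeomorphic sphere (0::real^2) 1" and "compact S" and "q \<in> S" and U: "open U" "q \<in> U"
  shows "U \<inter> inside S \<noteq> {}" "U \<inter> outside S \<noteq> {}"
proof -
  have conn: "connected (outside S)" and ne: "outside S \<noteq> {}"
    using \<open>compact S\<close> by (auto intro!: connected_outside outside_bounded_nonempty compact_imp_bounded)
  have "inside S \<noteq> {}"
  proof
    assume "inside S = {}"
    then have "connected (- S)" using conn inside_Un_outside[of S] by simp
    then show False using Jordan_Brouwer_separation[OF hom] by simp
  qed
  then obtain x where x: "x \<in> inside S" by blast
  have "connected_component_set (- S) x \<in> components (- S)"
    using x inside_Un_outside[of S] by (intro componentsI) blast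
  then have "frontier (connected_component_set (- S) x) = S"
    by (intro Jordan_Brouwer_frontier[OF hom]) auto
  then have "q \<in> closure (connected_component_set (- S) x)"
    using \<open>q \<in> S\<close> by (auto simp: frontier_def)
  then obtain y where "y \<in> U" "connected_component (- S) x y"
    using U by (auto simp: closure_iff_nhds_not_empty)
  then show "U \<inter> inside S \<noteq> {}" using inside_same_component x by blast
  have "frontier (outside S) = S"
    using outside_in_components conn ne by (intro Jordan_Brouwer_frontier[OF hom]) auto
  then have "q \<in> closure (outside S)" using \<open>q \<in> S\<close> by (auto simp: frontier_def)
  then show "U \<inter> outside S \<noteq> {}"
    using U by (auto simp: closure_iff_nhds_not_empty)
qed

lemma connected_subset_inside:
  assumes "connected T" "T \<subseteq> - S" "T \<inter> inside S \<noteq> {}"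
  shows "T \<subseteq> inside S"
proof
  fix y assume "y \<in> T"
  obtain x where "x \<in> T" "x \<in> inside S" using assms by blast
  moreover have "connected_component (- S) x y"
    using assms \<open>x \<in> T\<close> \<open>y \<in> T\<close> unfolding connected_component_def by blast
  ultimately show "y \<in> inside S" using inside_same_component by blast
qed

lemma connected_subset_outside:
  assumes "connected T" "T \<subseteq> - S" "T \<inter> outside S \<noteq> {}"
  shows "T \<subseteq> outside S"
proof
  fix y assume "y \<in> T"
  obtain x where "x \<in> T" "x \<in> outside S" using assms by blast
  moreover have "connected_component (- S) x y"
    using assms \<open>x \<in> T\<close> \<open>y \<in> T\<close> unfolding connected_component_def by blast
  ultimately show "y \<in> outside S" using outside_same_component by blast
qed

lemma continuous_on_vector_2:
  assumes "continuous_on S u" "continuous_on S v"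
  shows "continuous_on S (\<lambda>x. vector [u x, v x] :: real^2)"
proof -
  have "vector [u x, v x] = u x *\<^sub>R axis 1 1 + v x *\<^sub>R (axis 2 1 :: real^2)" for x
    by (simp add: vec_eq_2 axis_def)
  then show ?thesis using assms by (simp only:) (intro continuous_intros)
qed

section \<open>Flow boxes, and the inward normal determined by the side\<close>

context regular_C2_function
begin

definition chart :: "real^2 \<Rightarrow> real^2 \<Rightarrow> real^2" where "chart e p = vector [e \<bullet> p, f p]"

lemma chart_nth [simp]: "chart e p $ 1 = e \<bullet> p" "chart e p $ 2 = f p"
  by (simp_all add: chart_def)

lemma cont_chart: "continuous_on \<Omega> (chart e)"
  unfolding chart_def by (intro continuous_on_vector_2 continuous_intros cont_f)

text \<open>Invariance of domain turns continuity and injectivity, which \<open>chart_inj\<close>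
  supplies, into an open image and a continuous inverse.\<close>

lemma chart_homeomorphism:
  assumes "convex U" "open U" "U \<subseteq> \<Omega>" and pos: "\<And>p. p \<in> U \<Longrightarrow> 0 < e \<bullet> X p"
  obtains h where "homeomorphism U (chart e ` U) (chart e) h" "open (chart e ` U)"
proof -
  have "inj_on (chart e) U"
  proof (rule inj_onI)
    fix p p' assume p: "p \<in> U" "p' \<in> U" "chart e p = chart e p'"
    then have "e \<bullet> p = e \<bullet> p'" "f p = f p'" by (metis chart_nth)+
    then show "p = p'" using chart_inj[OF assms(1,3) pos] p by blast
  qed
  moreover have "continuous_on U (chart e)" using cont_chart assms(3) continuous_on_subset by blast
  ultimately show ?thesis
    using invariance_of_domain_homeomorphism[OF assms(2)] invariance_of_domain[OF _ assms(2)] that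
    by (metis order_refl)
qed

text \<open>Taking \<open>U\<close> as the preimage of a ball in the chart makes the parts below and
  above the level of \<open>q\<close> homeomorphic images of the ball cut by a half plane, hence
  connected.\<close>

lemma flow_box:
  assumes q: "q \<in> \<Omega>"
  obtains U where "open U" "q \<in> U" "U \<subseteq> \<Omega>" "connected {p \<in> U. f p < f q}" "connected {p \<in> U. f q < f p}"
proof -
  obtain r where r: "0 < r" "ball q r \<subseteq> \<Omega>" "\<And>p. p \<in> ball q r \<Longrightarrow> 0 < X q \<bullet> X p"
    using local_tangent_direction[OF q] by metis
  define e where "e = X q"
  obtain h where h: "homeomorphism (ball q r) (chart e ` ball q r) (chart e) h" "open (chart e ` ball q r)"
    using chart_homeomorphism[OF convex_ball open_ball r(2), of e] r(3) unfolding e_def by metis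
  have "chart e q \<in> chart e ` ball q r" using r(1) by simp
  then obtain d where d: "0 < d" "ball (chart e q) d \<subseteq> chart e ` ball q r"
    using h(2) open_contains_ball by blast
  define W where "W = ball (chart e q) d"
  define U where "U = ball q r \<inter> chart e -` W"
  have "open U" unfolding U_def W_def
    using r(2) cont_chart by (intro continuous_open_preimage) (auto intro: continuous_on_subset)
  moreover have "q \<in> U" "U \<subseteq> \<Omega>" using r d by (auto simp: U_def W_def)
  moreover have "connected {p \<in> U. chart e p \<in> V}" if "convex V" for V
  proof -
    have "continuous_on (W \<inter> V) h"
      using h(1) d(2) unfolding homeomorphism_def W_def by (meson Int_lower1 continuous_on_subset order_trans)
    then have "connected (h ` (W \<inter> V))"
      using that by (intro connected_continuous_image convex_connected convex_Int) (auto simp: W_def)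
    also have "h ` (W \<inter> V) = {p \<in> U. chart e p \<in> V}"
    proof
      show "h ` (W \<inter> V) \<subseteq> {p \<in> U. chart e p \<in> V}"
        using h(1) d(2) unfolding homeomorphism_def U_def W_def by force
      show "{p \<in> U. chart e p \<in> V} \<subseteq> h ` (W \<inter> V)"
        using h(1) unfolding homeomorphism_def U_def by force
    qed
    finally show ?thesis .
  qed
  note conn = this
  have "convex {z :: real^2. z $ 2 < f q}" "convex {z :: real^2. f q < z $ 2}"
    using convex_halfspace_lt[of "axis 2 1 :: real^2" "f q"] convex_halfspace_gt[of "f q" "axis 2 1 :: real^2"]
    by (simp_all add: inner_axis' )
  from this[THEN conn] have "connected {p \<in> U. f p < f q}" "connected {p \<in> U. f q < f p}" by simp_all
  ultimately show ?thesis using that by blast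
qed

lemma eventually_increasing:
  assumes q: "q \<in> \<Omega>" and "0 < G q \<bullet> v"
  shows "\<forall>\<^sub>F s in at_right 0. f q < f (q + s *\<^sub>R v)"
proof -
  have "((\<lambda>s. q + s *\<^sub>R v) has_vector_derivative v) (at 0)" by (auto intro!: derivative_eq_intros)
  from f_comp_deriv[OF this] q
  have "((\<lambda>s. f (q + s *\<^sub>R v)) has_real_derivative G q \<bullet> v) (at 0)" by simp
  from DERIV_pos_inc_right[OF this assms(2)] show ?thesis
    by (auto simp: eventually_at_right_field)
qed

lemma eventually_decreasing:
  assumes q: "q \<in> \<Omega>" and "G q \<bullet> v < 0"
  shows "\<forall>\<^sub>F s in at_right 0. f (q + s *\<^sub>R v) < f q"
proof -
  have "((\<lambda>s. q + s *\<^sub>R v) has_vector_derivative v) (at 0)" by (auto intro!: derivative_eq_intros)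
  from f_comp_deriv[OF this] q
  have "((\<lambda>s. f (q + s *\<^sub>R v)) has_real_derivative G q \<bullet> v) (at 0)" by simp
  from DERIV_neg_dec_right[OF this assms(2)] show ?thesis
    by (auto simp: eventually_at_right_field)
qed

lemma eventually_near:
  fixes U :: "(real^2) set"
  assumes "open U" "q \<in> U"
  shows "\<forall>\<^sub>F s in at_right 0. q + s *\<^sub>R v \<in> U"
proof -
  have "((\<lambda>s. q + s *\<^sub>R v) \<longlongrightarrow> q + 0 *\<^sub>R v) (at_right 0)" by (intro tendsto_intros)
  then show ?thesis using assms topological_tendstoD by fastforce
qed

text \<open>For \<open>\<sigma> = 1\<close> the values of \<open>f\<close> are smaller inside the level curve near \<open>q\<close>, for \<open>\<sigma> = -1\<close> larger.\<close>

definition side :: "real \<Rightarrow> real^2 \<Rightarrow> bool" where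
  "side \<sigma> q \<longleftrightarrow> (\<exists>U. open U \<and> q \<in> U \<and> U \<subseteq> \<Omega> \<and>
     (\<forall>p\<in>U. \<sigma> * (f p - f q) < 0 \<longrightarrow> p \<in> inside (level (f q))) \<and>
     (\<forall>p\<in>U. 0 < \<sigma> * (f p - f q) \<longrightarrow> p \<in> outside (level (f q))))"

lemma side_eventually:
  assumes "side \<sigma> q" "\<sigma> \<in> {1, -1}"
  shows "\<sigma> * (G q \<bullet> v) < 0 \<Longrightarrow> \<forall>\<^sub>F s in at_right 0. q + s *\<^sub>R v \<in> inside (level (f q))"
    and "0 < \<sigma> * (G q \<bullet> v) \<Longrightarrow> \<forall>\<^sub>F s in at_right 0. q + s *\<^sub>R v \<in> outside (level (f q))"
proof -
  obtain U where U: "open U" "q \<in> U" "U \<subseteq> \<Omega>"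
    "\<forall>p\<in>U. \<sigma> * (f p - f q) < 0 \<longrightarrow> p \<in> inside (level (f q))"
    "\<forall>p\<in>U. 0 < \<sigma> * (f p - f q) \<longrightarrow> p \<in> outside (level (f q))"
    using assms(1) unfolding side_def by blast
  have q: "q \<in> \<Omega>" using U by blast
  show "\<forall>\<^sub>F s in at_right 0. q + s *\<^sub>R v \<in> inside (level (f q))" if "\<sigma> * (G q \<bullet> v) < 0"
  proof -
    have "\<forall>\<^sub>F s in at_right 0. \<sigma> * (f (q + s *\<^sub>R v) - f q) < 0"
      using eventually_increasing[OF q, of v] eventually_decreasing[OF q, of v] assms(2) that by auto
    with eventually_near[OF U(1,2), of v] show ?thesis
      by eventually_elim (use U in auto)
  qed
  show "\<forall>\<^sub>F s in at_right 0. q + s *\<^sub>R v \<in> outside (level (f q))" if "0 < \<sigma> * (G q \<bullet> v)"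
  proof -
    have "\<forall>\<^sub>F s in at_right 0. 0 < \<sigma> * (f (q + s *\<^sub>R v) - f q)"
      using eventually_increasing[OF q, of v] eventually_decreasing[OF q, of v] assms(2) that by auto
    with eventually_near[OF U(1,2), of v] show ?thesis
      by eventually_elim (use U in auto)
  qed
qed

lemma not_eventually_inside_outside:
  fixes F :: "'b filter"
  assumes "\<forall>\<^sub>F s in F. \<gamma> s \<in> inside L" "\<forall>\<^sub>F s in F. \<gamma> s \<in> outside L" "F \<noteq> bot"
  shows False
proof -
  have "\<forall>\<^sub>F s in F. False"
    using assms(1,2) by eventually_elim (use inside_Int_outside in blast)
  then show False using assms(3) by simp
qed

lemma side_unique:
  assumes "side 1 q" "side (-1) q"
  shows False
proof -
  have "q \<in> \<Omega>" using assms(1) by (auto simp: side_def)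
  then have "0 < G q \<bullet> G q" using grad_nonzero by simp
  then have "\<forall>\<^sub>F s in at_right 0. q + s *\<^sub>R G q \<in> outside (level (f q))"
    "\<forall>\<^sub>F s in at_right 0. q + s *\<^sub>R G q \<in> inside (level (f q))"
    using assms by (auto intro: side_eventually)
  then show False using not_eventually_inside_outside by (metis trivial_limit_at_right_real)
qed

text \<open>The unique description of the inward normal is verified in two halves. Curves within the
  level set have velocity orthogonal to \<open>G q\<close>, so \<open>\<sigma> *\<^sub>R N\<close>
  qualifies; conversely the tangent vector \<open>X q\<close> leaves only the multiples of
  \<open>N\<close>, and the opposite unit vector points to the outside.\<close>

lemma orientation_sign_eq:
  assumes side: "side \<sigma> q" and \<sigma>: "\<sigma> \<in> {1, -1}" and tangent: "X q \<in> tangent_vectors (level (f q)) q"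
  shows "orientation_sign \<Omega> f q = \<sigma>"
proof -
  have q: "q \<in> \<Omega>" using side by (auto simp: side_def)
  define N where "N = unit_normal f q"
  have G: "norm (G q) \<noteq> 0" using grad_nonzero[OF q] by simp
  have "norm N = 1" using G by (simp add: N_def unit_normal_def)
  then have N: "norm N = 1" "N \<bullet> N = 1" using norm_eq_1 by blast+
  obtain m where m: "0 < m" and GN: "G q = - (m *\<^sub>R N)"
    using G by (intro that[of "norm (G q)"]) (auto simp: N_def unit_normal_def)
  have perp: "G q \<bullet> v = 0" if v: "v \<in> tangent_vectors (level (f q)) q" for v
  proof -
    obtain c where c: "c 0 = q" "\<forall>\<^sub>F s in nhds 0. c s \<in> level (f q)" "(c has_vector_derivative v) (at 0)"
      using v unfolding tangent_vectors_def by blast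
    have "((\<lambda>s. f (c s)) has_real_derivative G q \<bullet> v) (at 0)"
      using f_comp_deriv[OF c(3)] c(1) q by simp
    moreover have "\<forall>\<^sub>F s in nhds 0. f (c s) = f q"
      using c(2) by eventually_elim (simp add: preimage_in_def)
    then have "((\<lambda>s. f (c s)) has_real_derivative G q \<bullet> v) (at 0) \<longleftrightarrow>
        ((\<lambda>s. f q) has_real_derivative G q \<bullet> v) (at 0)"
      by (rule DERIV_cong_ev[OF refl _ refl])
    ultimately show ?thesis using DERIV_unique[OF _ DERIV_const] by blast
  qed
  have GsN: "\<sigma> * (G q \<bullet> (\<sigma> *\<^sub>R N)) < 0" using \<sigma> N m by (auto simp: GN)
  have "inward_unit_normal (level (f q)) q = \<sigma> *\<^sub>R N"
    unfolding inward_unit_normal_def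
  proof (rule the_equality, intro conjI ballI)
    show "norm (\<sigma> *\<^sub>R N) = 1" using N \<sigma> by auto
    show "(\<sigma> *\<^sub>R N) \<bullet> v = 0" if "v \<in> tangent_vectors (level (f q)) q" for v
      using perp[OF that] m by (simp add: GN)
    show "\<forall>\<^sub>F s in at_right 0. q + s *\<^sub>R (\<sigma> *\<^sub>R N) \<in> inside (level (f q))"
      by (rule side_eventually(1)[OF side \<sigma> GsN])
    fix n assume n: "norm n = 1 \<and> (\<forall>v\<in>tangent_vectors (level (f q)) q. n \<bullet> v = 0) \<and>
      (\<forall>\<^sub>F s in at_right 0. q + s *\<^sub>R n \<in> inside (level (f q)))"
    then have "X q \<bullet> n = 0" using tangent by (metis inner_commute)
    then obtain c where "n = c *\<^sub>R rot90 (X q)"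
      using orthogonal_2_imp_parallel X_nonzero[OF q] by metis
    moreover have "rot90 (X q) = - G q" by (simp add: X_def vec_eq_2)
    ultimately have "n = (c * m) *\<^sub>R N" by (simp add: GN)
    then obtain d where d: "n = d *\<^sub>R N" by blast
    then have "\<bar>d\<bar> = 1" using n N by simp
    then have "d = \<sigma> \<or> d = - \<sigma>" using \<sigma> by auto
    moreover have "d \<noteq> - \<sigma>"
    proof
      assume "d = - \<sigma>"
      then have "n = - (\<sigma> *\<^sub>R N)" using d by simp
      then have "\<sigma> * (G q \<bullet> n) > 0" using GsN by simp
      from side_eventually(2)[OF side \<sigma> this] n show False
        using not_eventually_inside_outside by (metis trivial_limit_at_right_real)
    qed
    ultimately show "n = \<sigma> *\<^sub>R N" using d by blast
  qed
  then show ?thesis using N by (simp add: orientation_sign_def N_def)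
qed

end

section \<open>The inside of a level curve lies on one side of its level\<close>

context level_annulus
begin

lemma level_paramD:
  assumes "level_param t \<gamma> P"
  shows "0 < P" "\<gamma> s \<in> level t" "\<gamma> s \<in> \<Omega>" "f (\<gamma> s) = t" "(\<gamma> has_vector_derivative X (\<gamma> s)) (at s)" "\<gamma> (s + P) = \<gamma> s"
    "inj_on \<gamma> {0..<P}" "\<gamma> ` {0..<P} = level t" "continuous_on S \<gamma>"
proof -
  show *: "0 < P" "\<gamma> s \<in> level t" "(\<gamma> has_vector_derivative X (\<gamma> s)) (at s)" "\<gamma> (s + P) = \<gamma> s"
    "inj_on \<gamma> {0..<P}" "\<gamma> ` {0..<P} = level t" for s
    using assms by (auto simp: level_param_def)
  show "\<gamma> s \<in> \<Omega>" "f (\<gamma> s) = t" using *(2)[of s] by (auto simp: level_iff)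
  show "continuous_on S \<gamma>"
    by (meson *(3) continuous_at_imp_continuous_on has_vector_derivative_continuous)
qed

lemma level_homeomorphic_circle:
  assumes t: "t \<in> {a..b}"
  shows "level t homeomorphic sphere (0::real^2) 1"
proof -
  obtain q where "q \<in> level t" using connected_level(2)[OF t] by blast
  then obtain \<gamma> P where "level_param t \<gamma> P" using level_param_exists[OF t] by metis
  note \<gamma> = level_paramD[OF this]
  define \<eta> where "\<eta> x = \<gamma> (P * x)" for x
  have \<gamma>P: "\<gamma> P = \<gamma> 0" using \<gamma>(6)[of 0] by simp
  have eq: "x = y" if "\<eta> x = \<eta> y" "x \<in> {0..<1}" "y \<in> {0..<1}" for x y
  proof -
    have "P * x = P * y" using that \<gamma>(1) unfolding \<eta>_def by (intro inj_onD[OF \<gamma>(7)]) auto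
    then show ?thesis using \<gamma>(1) by simp
  qed
  have \<eta>1: "\<eta> 1 = \<eta> 0" by (simp add: \<eta>_def \<gamma>P)
  have "simple_path \<eta>"
    unfolding simple_path_def loop_free_def path_def
  proof (intro conjI ballI impI)
    show "continuous_on {0..1} \<eta>"
      unfolding \<eta>_def by (intro continuous_on_compose2[OF \<gamma>(9)[of UNIV]] continuous_intros) auto
    fix x y :: real assume "x \<in> {0..1}" "y \<in> {0..1}" "\<eta> x = \<eta> y"
    then show "x = y \<or> x = 0 \<and> y = 1 \<or> x = 1 \<and> y = 0"
    proof -
      consider "x = 1" | "y = 1" | "x \<in> {0..<1}" "y \<in> {0..<1}"
        using \<open>x \<in> _\<close> \<open>y \<in> _\<close> by fastforce
      then show ?thesis
      proof cases
        case 1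
        then have "y = 1 \<or> y = 0"
          using eq[of y 0] \<eta>1 \<open>\<eta> x = \<eta> y\<close> \<open>y \<in> _\<close> by fastforce
        then show ?thesis using 1 by blast
      next
        case 2
        then have "x = 1 \<or> x = 0"
          using eq[of x 0] \<eta>1 \<open>\<eta> x = \<eta> y\<close> \<open>x \<in> _\<close> by fastforce
        then show ?thesis using 2 by blast
      next
        case 3
        then show ?thesis using eq \<open>\<eta> x = \<eta> y\<close> by blast
      qed
    qed
  qed
  moreover have "pathfinish \<eta> = pathstart \<eta>" by (simp add: pathfinish_def pathstart_def \<eta>1)
  moreover have "path_image \<eta> = level t"
  proof
    show "path_image \<eta> \<subseteq> level t" using \<gamma>(2) by (auto simp: path_image_def \<eta>_def)
    show "level t \<subseteq> path_image \<eta>"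
    proof
      fix p assume "p \<in> level t"
      then obtain s where s: "s \<in> {0..<P}" "p = \<gamma> s" using \<gamma>(8) by blast
      then show "p \<in> path_image \<eta>"
        using \<gamma>(1) unfolding path_image_def \<eta>_def by (intro image_eqI[of _ _ "s / P"]) auto
    qed
  qed
  ultimately have "level t homeomorphic sphere (0::complex) 1"
    using homeomorphic_simple_path_image_circle[of \<eta> 1 0] by simp
  moreover have "sphere (0::complex) 1 homeomorphic sphere (0::real^2) 1"
    by (rule homeomorphic_spheres_gen) auto
  ultimately show ?thesis using homeomorphic_trans by blast
qed

text \<open>In a flow box the two halves are connected and avoid the curve, so each lies entirely
  inside or entirely outside. Both inside and outside occur near \<open>q\<close>, so the halves are
  on opposite sides.\<close>

lemma side_exists:
  assumes t: "t \<in> {a..b}" and q: "q \<in> level t"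
  shows "side 1 q \<or> side (-1) q"
proof -
  have q': "q \<in> \<Omega>" "f q = t" using q by (auto simp: level_iff)
  obtain U where U: "open U" "q \<in> U" "U \<subseteq> \<Omega>" "connected {p \<in> U. f p < t}" "connected {p \<in> U. t < f p}"
    by (rule flow_box[OF q'(1), unfolded q'(2)])
  let ?lo = "{p \<in> U. f p < t}" and ?hi = "{p \<in> U. t < f p}" and ?L = "level t"
  have lo: "?lo \<subseteq> - ?L" and hi: "?hi \<subseteq> - ?L" by (auto simp: level_iff)
  have "U \<subseteq> ?lo \<union> ?hi \<union> ?L" using U(3) by (auto simp: level_iff)
  then have sub: "U \<inter> inside ?L \<subseteq> ?lo \<union> ?hi" "U \<inter> outside ?L \<subseteq> ?lo \<union> ?hi"
    using inside_no_overlap[of ?L] outside_no_overlap[of ?L] by blast+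
  have ne: "U \<inter> inside ?L \<noteq> {}" "U \<inter> outside ?L \<noteq> {}"
    using Jordan_curve_both_sides[OF level_homeomorphic_circle[OF t] compact_level[OF t] q U(1,2)] by auto
  have disj: "inside ?L \<inter> outside ?L = {}" by simp
  consider "?lo \<inter> inside ?L \<noteq> {}" | "?hi \<inter> inside ?L \<noteq> {}" using sub(1) ne(1) by blast
  then show ?thesis
  proof cases
    case 1
    then have "?lo \<subseteq> inside ?L" using connected_subset_inside[OF U(4) lo] by blast
    moreover from this have "?hi \<subseteq> outside ?L"
      using connected_subset_outside[OF U(5) hi] sub(2) ne(2) disj by blast
    ultimately have "side 1 q" unfolding side_def q'(2) using U(1-3) by (intro exI[of _ U]) auto
    then show ?thesis ..
  next
    case 2
    then have "?hi \<subseteq> inside ?L" using connected_subset_inside[OF U(5) hi] by blast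
    moreover from this have "?lo \<subseteq> outside ?L"
      using connected_subset_outside[OF U(4) lo] sub(2) ne(2) disj by blast
    ultimately have "side (-1) q" unfolding side_def q'(2) using U(1-3) by (intro exI[of _ U]) auto
    then show ?thesis ..
  qed
qed

text \<open>The neighbourhood witnessing a side at \<open>q\<close> witnesses it for every point of
  the level set that it contains. Thus the two possibilities split the connected level set into two
  disjoint open parts.\<close>

lemma side_constant:
  assumes t: "t \<in> {a..b}"
  obtains \<sigma> where "\<sigma> \<in> {1, -1}" "\<And>q. q \<in> level t \<Longrightarrow> side \<sigma> q"
proof -
  have op: "openin (top_of_set (level t)) {q \<in> level t. side \<sigma> q}" for \<sigma>
  proof (subst openin_subopen, intro ballI)
    fix q assume q: "q \<in> {q \<in> level t. side \<sigma> q}"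
    then obtain U where U: "open U" "q \<in> U" "U \<subseteq> \<Omega>"
      "\<forall>p\<in>U. \<sigma> * (f p - f q) < 0 \<longrightarrow> p \<in> inside (level (f q))"
      "\<forall>p\<in>U. 0 < \<sigma> * (f p - f q) \<longrightarrow> p \<in> outside (level (f q))"
      unfolding side_def by blast
    have "level t \<inter> U \<subseteq> {q \<in> level t. side \<sigma> q}"
    proof
      fix p assume p: "p \<in> level t \<inter> U"
      then have "f p = f q" using q by (simp add: level_iff)
      then show "p \<in> {q \<in> level t. side \<sigma> q}"
        using p U unfolding side_def by (intro CollectI conjI exI[of _ U]) auto
    qed
    then show "\<exists>T. openin (top_of_set (level t)) T \<and> q \<in> T \<and> T \<subseteq> {q \<in> level t. side \<sigma> q}"
      using q U(1,2) by (intro exI[of _ "level t \<inter> U"]) (auto simp: openin_open_Int)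
  qed
  have "level t - {q \<in> level t. side 1 q} = {q \<in> level t. side (-1) q}"
    using side_exists[OF t] side_unique by blast
  then have "closedin (top_of_set (level t)) {q \<in> level t. side 1 q}"
    using op[of "-1"] by (auto simp: closedin_def)
  then have "{q \<in> level t. side 1 q} = {} \<or> {q \<in> level t. side 1 q} = level t"
    using op[of 1] connected_level(1)[OF t] unfolding connected_clopen by blast
  then show ?thesis
  proof
    assume "{q \<in> level t. side 1 q} = {}"
    then have "\<And>q. q \<in> level t \<Longrightarrow> side (-1) q" using side_exists[OF t] by blast
    then show ?thesis by (intro that[of "-1"]) auto
  next
    assume "{q \<in> level t. side 1 q} = level t"
    then show ?thesis by (intro that[of 1]) auto
  qed
qed

end

subsection \<open>The orientation is the turning number\<close>

definition complex_of_vec :: "real^2 \<Rightarrow> complex" where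
  "complex_of_vec v = Complex (v $ 1) (v $ 2)"

lemma complex_of_vec_sel [simp]: "Re (complex_of_vec v) = v $ 1" "Im (complex_of_vec v) = v $ 2"
  by (simp_all add: complex_of_vec_def)

lemma complex_of_vec_eq_iff [simp]: "complex_of_vec u = complex_of_vec v \<longleftrightarrow> u = v"
  by (simp add: complex_eq_iff vec_eq_2)

lemma complex_of_vec_eq_0_iff [simp]: "complex_of_vec v = 0 \<longleftrightarrow> v = 0"
  by (simp add: complex_eq_iff vec_eq_2)

lemma bounded_linear_complex_of_vec: "bounded_linear complex_of_vec"
  unfolding linear_conv_bounded_linear[symmetric]
  by (rule linearI) (simp_all add: complex_eq_iff)

text \<open>With \<open>v = X p\<close> and \<open>w = H p (X p)\<close> the numerator on the left
  is the acceleration of the orbit through \<open>p\<close> and the denominator its velocity. The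
  logarithmic derivative in Hopf's theorem thus has imaginary part \<open>g\<close>.\<close>

lemma Im_complex_of_vec_divide:
  "Im (complex_of_vec (rot90 w) / complex_of_vec v) = (v \<bullet> w) / (v \<bullet> v)"
  by (simp add: Im_divide inner_2 power2_eq_square mult.commute)

context level_annulus
begin

definition lowest :: "real^2 \<Rightarrow> bool" where
  "lowest q \<longleftrightarrow> (\<forall>p\<in>level (f q). q $ 2 \<le> p $ 2)"

lemma lowest_exists:
  assumes "t \<in> {a..b}"
  obtains q where "q \<in> level t" "lowest q"
proof -
  have "continuous_on (level t) (\<lambda>p. p $ 2)" by (intro continuous_intros)
  then obtain q where "q \<in> level t" "\<forall>p\<in>level t. q $ 2 \<le> p $ 2"
    using continuous_attains_inf[OF compact_level[OF assms] connected_level(2)[OF assms]] by blast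
  then show ?thesis using that by (auto simp: lowest_def level_iff)
qed

lemma lowest_grad:
  assumes "q \<in> K" "lowest q"
  shows "G q $ 1 = 0" "G q $ 2 \<noteq> 0"
proof -
  define t where "t = f q"
  have t: "t \<in> {a..b}" "q \<in> level t" using assms by (auto simp: t_def level_iff K_iff)
  obtain \<gamma> P where param: "level_param t \<gamma> P" and \<gamma>0: "\<gamma> 0 = q"
    by (rule level_param_exists[OF t])
  note \<gamma> = level_paramD[OF param]
  have "((\<lambda>s. \<gamma> s $ 2) has_real_derivative X (\<gamma> 0) $ 2) (at 0)"
    using bounded_linear.has_vector_derivative[OF bounded_linear_vec_nth \<gamma>(5)]
    by (simp add: has_real_derivative_iff_has_vector_derivative)
  moreover have "\<gamma> 0 $ 2 \<le> \<gamma> s $ 2" for s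
    using assms(2) \<gamma>(2)[of s] by (simp add: lowest_def \<gamma>0 t_def)
  ultimately have "X (\<gamma> 0) $ 2 = 0" by (intro DERIV_local_min[of _ _ _ 1]) auto
  then show "G q $ 1 = 0" by (simp add: \<gamma>0 X_def)
  moreover have "G q \<noteq> 0" using assms(1) grad_nonzero K_subset by blast
  ultimately show "G q $ 2 \<noteq> 0" by (simp add: vec_eq_2)
qed

lemma side_lowest:
  assumes "q \<in> K" "lowest q" "side \<sigma> q" "\<sigma> \<in> {1, -1}"
  shows "sgn (- G q $ 2) = \<sigma>"
proof (rule ccontr)
  assume "sgn (- G q $ 2) \<noteq> \<sigma>"
  \<comment> \<open>With the opposite sign, the inside of the curve would begin directly below its
    lowest point.\<close>
  then have "0 < \<sigma> * G q $ 2"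
    using lowest_grad[OF assms(1,2)] assms(4) by (auto simp: sgn_if split: if_splits)
  then have "\<sigma> * (G q \<bullet> (- axis 2 1)) < 0" by (simp add: inner_axis)
  then have "\<forall>\<^sub>F s in at_right 0. q + s *\<^sub>R (- axis 2 1) \<in> inside (level (f q))"
    by (rule side_eventually(1)[OF assms(3,4)])
  moreover have "\<forall>\<^sub>F s in at_right 0. q + s *\<^sub>R (- axis 2 1) \<in> outside (level (f q))"
    using eventually_at_right_less[of 0]
  proof eventually_elim
    fix s :: real assume "0 < s"
    \<comment> \<open>The whole curve lies in this closed half plane. Points off a convex set are
      outside it, and they remain outside any subset.\<close>
    define S where "S = {p :: real^2. q $ 2 \<le> p $ 2}"
    have "convex S"
      using convex_halfspace_ge[of "q $ 2" "axis 2 1 :: real^2"] by (simp add: S_def inner_axis')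
    moreover have "q + s *\<^sub>R (- axis 2 1) \<notin> S" using \<open>0 < s\<close> by (simp add: S_def axis_def)
    ultimately have "q + s *\<^sub>R (- axis 2 1) \<in> outside S" by (rule convex_in_outside)
    moreover have "level (f q) \<subseteq> S" using assms(2) by (auto simp: lowest_def S_def)
    ultimately show "q + s *\<^sub>R (- axis 2 1) \<in> outside (level (f q))" using outside_mono by blast
  qed
  ultimately show False
    by (rule not_eventually_inside_outside) (rule trivial_limit_at_right_real)
qed

lemma level_turning_number:
  assumes param: "level_param t \<gamma> P" and "lowest (\<gamma> 0)" and t: "t \<in> {a..b}"
  shows "integral {0..P} (\<lambda>s. g (\<gamma> s)) = sgn (- G (\<gamma> 0) $ 2) * (2 * pi)"
proof -
  note \<gamma> = level_paramD[OF param]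
  define c c' c'' where "c s = complex_of_vec (\<gamma> s)" and "c' s = complex_of_vec (X (\<gamma> s))"
    and "c'' s = complex_of_vec (rot90 (H (\<gamma> s) (X (\<gamma> s))))" for s
  have "integral {0..P} (\<lambda>s. Im (c'' s / c' s)) = sgn (Re (c' 0)) * (2 * pi)"
  proof (rule turning_number_simple_closed_curve)
    show "(c has_vector_derivative c' s) (at s)" for s
      unfolding c_def c'_def
      by (rule bounded_linear.has_vector_derivative[OF bounded_linear_complex_of_vec \<gamma>(5)])
    show "(c' has_vector_derivative c'' s) (at s)" for s
    proof -
      have "((\<lambda>s. X (\<gamma> s)) has_derivative (\<lambda>h. rot90 (H (\<gamma> s) (h *\<^sub>R X (\<gamma> s))))) (at s)"
        using has_derivative_compose[OF \<gamma>(5)[unfolded has_vector_derivative_def] X_deriv[OF \<gamma>(3)]] .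
      then have "((\<lambda>s. X (\<gamma> s)) has_vector_derivative rot90 (H (\<gamma> s) (X (\<gamma> s)))) (at s)"
        unfolding has_vector_derivative_def
        by (simp add: linear_cmul[OF linear_H[OF \<gamma>(3)]] linear_cmul[OF linear_rot90])
      then show ?thesis
        unfolding c'_def c''_def
        by (rule bounded_linear.has_vector_derivative[OF bounded_linear_complex_of_vec])
    qed
    show "continuous_on UNIV c''"
      unfolding c''_def
      by (intro bounded_linear.continuous_on[OF bounded_linear_complex_of_vec]
          bounded_linear.continuous_on[OF bounded_linear_rot90] cont_H_comp
          continuous_on_compose2[OF cont_X] \<gamma>(9)) (use \<gamma>(3) in auto)
    show "0 < P" by (rule \<gamma>(1))
    show "c (s + P) = c s" for s by (simp add: c_def \<gamma>(6))
    show "inj_on c {0..<P}" using \<gamma>(7) by (auto simp: inj_on_def c_def)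
    show "c' s \<noteq> 0" for s using X_nonzero[OF \<gamma>(3)] by (simp add: c'_def)
    show "Im (c 0) \<le> Im (c s)" for s
      using assms(2) \<gamma>(2)[of s] \<gamma>(4)[of 0] by (simp add: c_def lowest_def)
  qed
  moreover have "Im (c'' s / c' s) = g (\<gamma> s)" for s
    unfolding c''_def c'_def Im_complex_of_vec_divide g_eq[OF \<gamma>(3)] ..
  moreover have "Re (c' 0) = - G (\<gamma> 0) $ 2" by (simp add: c'_def X_def)
  ultimately show ?thesis by simp
qed

text \<open>The lowest points of either sign form a compact set, so the corresponding levels form
  two closed sets covering \<open>{a..b}\<close>. They are disjoint, since at every lowest point of
  one level the sign is the side of that level. Connectedness of the interval leaves only one
  sign.\<close>

lemma lowest_sign_constant:
  obtains \<sigma> where "\<sigma> \<in> {1, -1}" "\<And>q. q \<in> K \<Longrightarrow> lowest q \<Longrightarrow> sgn (- G q $ 2) = \<sigma>"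
proof -
  obtain r where r: "\<forall>p\<in>K. \<forall>t\<in>{a..b}. r p t \<in> level t" "\<forall>p. r p (f p) = p"
    "continuous_on (K \<times> {a..b}) (\<lambda>(p, t). r p t)"
    by (rule level_retraction)
  have contK: "continuous_on K f" "continuous_on K G"
    using cont_f cont_G K_subset continuous_on_subset by blast+
  \<comment> \<open>The competing points of the level of \<open>q\<close> are rewritten as
    retractions of points of \<open>K\<close>. The index set no longer varies with \<open>q\<close>,
    so the condition is an intersection of closed ones.\<close>
  have lowest: "lowest q \<longleftrightarrow> (\<forall>p\<in>K. q $ 2 \<le> r p (f q) $ 2)" if q: "q \<in> K" for q
  proof -
    have t: "f q \<in> {a..b}" using q by (simp add: K_iff)
    have "p \<in> K \<and> r p (f q) = p" if "p \<in> level (f q)" for p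
      using that r(2) level_subset_K[OF t] by (metis level_iff subsetD)
    then show ?thesis using r(1) q t unfolding lowest_def by metis
  qed
  \<comment> \<open>The weak inequality keeps the set closed; since \<open>G q $ 2\<close> never
    vanishes at a lowest point, it still determines the sign.\<close>
  define M where "M \<sigma> = {q \<in> K. lowest q \<and> 0 \<le> \<sigma> * - G q $ 2}" for \<sigma> :: real
  have "compact (M \<sigma>)" for \<sigma>
  proof -
    have "closedin (top_of_set K) {q \<in> K. q $ 2 \<le> r p (f q) $ 2}" if "p \<in> K" for p
    proof -
      have c: "continuous_on K (\<lambda>q. (p, f q))" by (intro continuous_intros contK)
      have "(\<lambda>q. (p, f q)) ` K \<subseteq> K \<times> {a..b}" using that by (auto simp: K_iff)
      from continuous_on_compose2[OF r(3) c this] have "continuous_on K (\<lambda>q. r p (f q))" by simp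
      then have "continuous_on K (\<lambda>q. r p (f q) $ 2 - q $ 2)" by (intro continuous_intros)
      then have "closedin (top_of_set K) (K \<inter> (\<lambda>q. r p (f q) $ 2 - q $ 2) -` {0..})"
        by (intro continuous_closedin_preimage) auto
      also have "K \<inter> (\<lambda>q. r p (f q) $ 2 - q $ 2) -` {0..} = {q \<in> K. q $ 2 \<le> r p (f q) $ 2}" by auto
      finally show ?thesis .
    qed
    then have "closedin (top_of_set K) (\<Inter>p\<in>K. {q \<in> K. q $ 2 \<le> r p (f q) $ 2})"
      using K_nonempty by (intro closedin_Inter) auto
    moreover have "closedin (top_of_set K) (K \<inter> (\<lambda>q. \<sigma> * - G q $ 2) -` {0..})"
      by (intro continuous_closedin_preimage continuous_intros contK)
    ultimately have "closedin (top_of_set K)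
        ((\<Inter>p\<in>K. {q \<in> K. q $ 2 \<le> r p (f q) $ 2}) \<inter> (K \<inter> (\<lambda>q. \<sigma> * - G q $ 2) -` {0..}))"
      by (rule closedin_Int)
    also have "(\<Inter>p\<in>K. {q \<in> K. q $ 2 \<le> r p (f q) $ 2}) \<inter> (K \<inter> (\<lambda>q. \<sigma> * - G q $ 2) -` {0..}) = M \<sigma>"
    proof -
      have "x \<in> (\<Inter>p\<in>K. {q \<in> K. q $ 2 \<le> r p (f q) $ 2}) \<longleftrightarrow> x \<in> K \<and> lowest x" for x
        using K_nonempty lowest[of x] by blast
      then show ?thesis unfolding M_def by auto
    qed
    finally show ?thesis using compact_annulus closedin_compact by blast
  qed
  then have closed: "closed (f ` M \<sigma>)" for \<sigma>
    using contK(1) by (intro compact_imp_closed compact_continuous_image)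
      (auto simp: M_def intro: continuous_on_subset)
  have nz: "G q $ 2 \<noteq> 0" if "q \<in> M \<sigma>" for q \<sigma>
    using that lowest_grad by (simp add: M_def)
  have sgnM: "sgn (- G q $ 2) = \<sigma>" if "q \<in> M \<sigma>" "\<sigma> \<in> {1, -1}" for q \<sigma>
    using that nz[OF that(1)] by (auto simp: M_def sgn_if)
  have sgn_level: "sgn (- G q $ 2) = sgn (- G q' $ 2)"
    if "q \<in> K" "q' \<in> K" "lowest q" "lowest q'" "f q = f q'" for q q'
  proof -
    have "f q \<in> {a..b}" using that(1) by (simp add: K_iff)
    then obtain \<sigma> where "\<sigma> \<in> {1, -1}" "\<And>p. p \<in> level (f q) \<Longrightarrow> side \<sigma> p"
      using side_constant by metis
    moreover have "q \<in> level (f q)" "q' \<in> level (f q)" using that by (auto simp: level_iff K_iff)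
    ultimately show ?thesis using side_lowest that by metis
  qed
  have "{a..b} \<subseteq> f ` M 1 \<union> f ` M (-1)"
  proof
    fix t assume t: "t \<in> {a..b}"
    obtain q where q: "q \<in> level t" "lowest q" by (rule lowest_exists[OF t])
    then have "q \<in> K" "f q = t" using level_subset_K[OF t] by (auto simp: level_iff)
    then have "q \<in> M 1 \<union> M (-1)" using q unfolding M_def by auto
    then show "t \<in> f ` M 1 \<union> f ` M (-1)" using \<open>f q = t\<close> by blast
  qed
  moreover have "f ` M 1 \<inter> f ` M (-1) = {}"
  proof -
    have False if "q \<in> M 1" "q' \<in> M (-1)" "f q = f q'" for q q'
      using sgn_level[of q q'] sgnM[OF that(1)] sgnM[OF that(2)] that by (auto simp: M_def)
    then show ?thesis by (auto simp: image_iff)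
  qed
  ultimately have "f ` M 1 \<inter> {a..b} = {} \<or> f ` M (-1) \<inter> {a..b} = {}"
    by (intro connected_closedD[OF connected_Icc] closed) auto
  moreover have "M \<sigma> = {}" if "f ` M \<sigma> \<inter> {a..b} = {}" for \<sigma>
    using that by (auto simp: M_def K_iff)
  ultimately have "M 1 = {} \<or> M (-1) = {}" by blast
  then have "\<exists>\<sigma>::real. \<sigma> \<in> {1, -1} \<and> M (- \<sigma>) = {}"
  proof
    assume "M 1 = {}" then show ?thesis by (intro exI[of _ "-1"]) simp
  next
    assume "M (-1) = {}" then show ?thesis by (intro exI[of _ 1]) simp
  qed
  then obtain \<sigma> :: real where \<sigma>: "\<sigma> \<in> {1, -1}" "M (- \<sigma>) = {}" by blast
  show ?thesis
  proof (rule that[OF \<sigma>(1)])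
    fix q assume q: "q \<in> K" "lowest q"
    then have "q \<in> M \<sigma>" using \<sigma>(2) unfolding M_def by auto
    then show "sgn (- G q $ 2) = \<sigma>" using sgnM \<sigma>(1) by blast
  qed
qed

lemma orientation_and_turning:
  obtains \<sigma> where "\<sigma> \<in> {1, -1}" "\<forall>p\<in>K. orientation_sign \<Omega> f p = \<sigma>"
    "\<forall>t\<in>{a..b}. \<exists>\<gamma> P. level_param t \<gamma> P \<and> integral {0..P} (\<lambda>s. g (\<gamma> s)) = \<sigma> * (2 * pi)"
proof -
  obtain \<sigma> where \<sigma>: "\<sigma> \<in> {1, -1}" "\<And>q. q \<in> K \<Longrightarrow> lowest q \<Longrightarrow> sgn (- G q $ 2) = \<sigma>"
    using lowest_sign_constant by metis
  show ?thesis
  proof (rule that[OF \<sigma>(1)]; intro ballI)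
    fix p assume p: "p \<in> K"
    define t where "t = f p"
    have t: "t \<in> {a..b}" "p \<in> level t" using p by (auto simp: t_def K_iff level_iff)
    obtain \<tau> where \<tau>: "\<tau> \<in> {1, -1}" "\<And>q. q \<in> level t \<Longrightarrow> side \<tau> q"
      using side_constant[OF t(1)] by metis
    obtain q where q: "q \<in> level t" "lowest q" by (rule lowest_exists[OF t(1)])
    have "q \<in> K" using q level_subset_K[OF t(1)] by blast
    \<comment> \<open>The side found at \<open>p\<close> is constant on its level, so it can be read
      off at a lowest point of that level.\<close>
    then have "\<tau> = \<sigma>" using side_lowest[OF _ q(2) \<tau>(2)[OF q(1)] \<tau>(1)] \<sigma>(2) q(2) by metis
    moreover have "X p \<in> tangent_vectors (level (f p)) p"
    proof -
      obtain \<gamma> P where param: "level_param t \<gamma> P" and "\<gamma> 0 = p"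
        by (rule level_param_exists[OF t])
      then show ?thesis
        using level_paramD(2,5)[OF param] unfolding tangent_vectors_def t_def[symmetric]
        by (intro CollectI exI[of _ \<gamma>]) auto
    qed
    ultimately show "orientation_sign \<Omega> f p = \<sigma>"
      using orientation_sign_eq \<tau> t(2) \<sigma>(1) by blast
  next
    fix t assume t: "t \<in> {a..b}"
    obtain q where q: "q \<in> level t" "lowest q" by (rule lowest_exists[OF t])
    obtain \<gamma> P where param: "level_param t \<gamma> P" and \<gamma>0: "\<gamma> 0 = q"
      by (rule level_param_exists[OF t q(1)])
    have "q \<in> K" using q level_subset_K[OF t] by blast
    then have "sgn (- G q $ 2) = \<sigma>" using \<sigma>(2) q(2) by blast
    moreover have "lowest (\<gamma> 0)" using q(2) \<gamma>0 by simp
    ultimately have "integral {0..P} (\<lambda>s. g (\<gamma> s)) = \<sigma> * (2 * pi)"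
      using level_turning_number[OF param _ t] unfolding \<gamma>0 by blast
    then show "\<exists>\<gamma> P. level_param t \<gamma> P \<and> integral {0..P} (\<lambda>s. g (\<gamma> s)) = \<sigma> * (2 * pi)"
      using param by blast
  qed
qed

end

subsection \<open>A coarea formula for the level curves\<close>

lemma Basis_real_2: "(Basis :: (real^2) set) = {axis 1 1, axis 2 1}"
  by (auto simp: Basis_vec_def UNIV_2)

lemma measurable_vector_2: "(\<lambda>(x, y). vector [x, y] :: real^2) \<in> borel_measurable (lborel \<Otimes>\<^sub>M lborel)"
proof -
  have "continuous_on UNIV (\<lambda>z. vector [fst z, snd z] :: real^2)"
    by (intro continuous_on_vector_2 continuous_intros)
  then have "(\<lambda>z. vector [fst z, snd z] :: real^2) \<in> borel_measurable borel"
    by (rule borel_measurable_continuous_onI)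
  then show ?thesis by (simp add: lborel_prod case_prod_unfold)
qed

text \<open>Both measures give every open box the product of its side lengths. This carries Fubini's
  theorem from pairs over to vectors, the second coordinate becoming the level.\<close>

lemma lborel_real_2: "(lborel :: (real^2) measure) = distr (lborel \<Otimes>\<^sub>M lborel) borel (\<lambda>(x, y). vector [x, y])"
proof (rule lborel_eqI)
  fix l u :: "real^2" assume le: "\<And>b. b \<in> Basis \<Longrightarrow> l \<bullet> b \<le> u \<bullet> b"
  have "l $ 1 \<le> u $ 1" "l $ 2 \<le> u $ 2"
    using le[of "axis 1 1"] le[of "axis 2 1"] by (simp_all add: Basis_real_2 inner_axis)
  have "(\<lambda>(x, y). vector [x, y]) -` box l u = {l $ 1<..<u $ 1} \<times> {l $ 2<..<u $ 2}"
    by (auto simp: box_def Basis_real_2 inner_axis)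
  then have "emeasure (distr (lborel \<Otimes>\<^sub>M lborel) borel (\<lambda>(x, y). vector [x, y])) (box l u)
      = emeasure (lborel \<Otimes>\<^sub>M lborel) ({l $ 1<..<u $ 1} \<times> {l $ 2<..<u $ 2})"
    using measurable_vector_2 by (subst emeasure_distr) (auto simp: space_pair_measure)
  also have "\<dots> = ennreal (u $ 1 - l $ 1) * ennreal (u $ 2 - l $ 2)"
    using \<open>l $ 1 \<le> u $ 1\<close> \<open>l $ 2 \<le> u $ 2\<close> by (subst lborel.emeasure_pair_measure_Times) auto
  also have "\<dots> = (\<Prod>b\<in>Basis. (u - l) \<bullet> b)"
    using \<open>l $ 1 \<le> u $ 1\<close> \<open>l $ 2 \<le> u $ 2\<close>
    by (simp add: Basis_real_2 inner_axis axis_eq_axis ennreal_mult)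
  finally show "emeasure (distr (lborel \<Otimes>\<^sub>M lborel) borel (\<lambda>(x, y). vector [x, y])) (box l u)
      = (\<Prod>b\<in>Basis. (u - l) \<bullet> b)" .
qed simp

lemma Fubini_real_2:
  fixes w :: "real^2 \<Rightarrow> real"
  assumes "integrable lborel w"
  shows "integrable lborel (\<lambda>t. \<integral>x. w (vector [x, t]) \<partial>lborel)"
    and "(\<integral>t. (\<integral>x. w (vector [x, t]) \<partial>lborel) \<partial>lborel) = integral\<^sup>L lborel w"
proof -
  have w: "w \<in> borel_measurable borel" using borel_measurable_integrable[OF assms] by simp
  have "integrable (distr (lborel \<Otimes>\<^sub>M lborel) borel (\<lambda>(x, y). vector [x, y])) w"
    using assms lborel_real_2 by simp
  then have i: "integrable (lborel \<Otimes>\<^sub>M lborel) (\<lambda>(x, t). w (vector [x, t]))"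
    by (subst (asm) integrable_distr_eq[OF measurable_vector_2 w]) (simp add: case_prod_unfold)
  show "integrable lborel (\<lambda>t. \<integral>x. w (vector [x, t]) \<partial>lborel)"
    by (rule lborel_pair.integrable_snd[OF i])
  have "(\<integral>t. (\<integral>x. w (vector [x, t]) \<partial>lborel) \<partial>lborel)
      = integral\<^sup>L (lborel \<Otimes>\<^sub>M lborel) (\<lambda>(x, t). w (vector [x, t]))"
    by (rule lborel_pair.integral_snd[OF i])
  also have "\<dots> = integral\<^sup>L (distr (lborel \<Otimes>\<^sub>M lborel) borel (\<lambda>(x, y). vector [x, y])) w"
    by (subst integral_distr[OF measurable_vector_2 w]) (simp add: case_prod_unfold)
  also have "\<dots> = integral\<^sup>L lborel w" using lborel_real_2 by simp
  finally show "(\<integral>t. (\<integral>x. w (vector [x, t]) \<partial>lborel) \<partial>lborel) = integral\<^sup>L lborel w" .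
qed

lemma has_absolute_integral_change_of_variables_real:
  fixes f :: "real^'m::{finite,wellorder} \<Rightarrow> real" and h :: "real^'m::_ \<Rightarrow> real^'m::_"
  assumes S: "S \<in> sets lebesgue"
    and der: "\<And>x. x \<in> S \<Longrightarrow> (h has_derivative h' x) (at x within S)" and inj: "inj_on h S"
  shows "(\<lambda>x. \<bar>det (matrix (h' x))\<bar> * f (h x)) absolutely_integrable_on S \<and>
           integral S (\<lambda>x. \<bar>det (matrix (h' x))\<bar> * f (h x)) = b
     \<longleftrightarrow> f absolutely_integrable_on (h ` S) \<and> integral (h ` S) f = b"
proof -
  have "(\<lambda>x. \<bar>det (matrix (h' x))\<bar> *\<^sub>R vec (f (h x)) :: real ^ 1) absolutely_integrable_on S \<and>
           integral S (\<lambda>x. \<bar>det (matrix (h' x))\<bar> *\<^sub>R vec (f (h x))) = (vec b :: real ^ 1)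
         \<longleftrightarrow> (\<lambda>x. vec (f x) :: real ^ 1) absolutely_integrable_on (h ` S) \<and>
           integral (h ` S) (\<lambda>x. vec (f x)) = (vec b :: real ^ 1)"
    by (intro has_absolute_integral_change_of_variables assms)
  then show ?thesis by (simp add: absolutely_integrable_on_1_iff integral_on_1_eq)
qed

lemma set_integrable_lborel_iff:
  fixes f :: "'a::euclidean_space \<Rightarrow> real"
  assumes "set_borel_measurable borel S f"
  shows "set_integrable lborel S f \<longleftrightarrow> f absolutely_integrable_on S"
  using assms unfolding set_integrable_def set_borel_measurable_def
  by (subst integrable_completion) auto

lemma set_integrable_lborel_imp_absolutely_integrable:
  fixes f :: "'a::euclidean_space \<Rightarrow> real"
  assumes "set_integrable lborel S f"
  shows "f absolutely_integrable_on S"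
proof -
  have "set_borel_measurable borel S f"
    using borel_measurable_integrable[OF assms[unfolded set_integrable_def]]
    by (simp add: set_borel_measurable_def)
  then show ?thesis using assms by (simp add: set_integrable_lborel_iff)
qed

lemma set_borel_measurable_continuous_on:
  fixes f :: "'a::topological_space \<Rightarrow> real"
  assumes "B \<in> sets borel" "U \<in> sets borel" "B \<subseteq> U" "continuous_on U f"
  shows "set_borel_measurable borel B f"
proof -
  have [measurable]: "(\<lambda>x. indicator U x *\<^sub>R f x) \<in> borel_measurable borel"
    by (rule borel_measurable_continuous_on_indicator[OF assms(2,4)])
  have [measurable]: "B \<in> sets borel" by (rule assms)
  have "(\<lambda>x. indicator B x *\<^sub>R (indicator U x *\<^sub>R f x)) \<in> borel_measurable borel" by measurable
  moreover have "indicator B x *\<^sub>R (indicator U x *\<^sub>R f x) = indicator B x *\<^sub>R f x" for x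
    using assms(3) by (auto simp: indicator_def)
  ultimately show ?thesis unfolding set_borel_measurable_def by (simp only:)
qed

section \<open>Localisation of the coarea formula and the final integration\<close>

context level_annulus
begin

lemma integrable_g:
  assumes "B \<in> sets borel" "B \<subseteq> K"
  shows "set_integrable lborel B g"
proof -
  have "set_integrable lborel K g"
    unfolding set_integrable_def
    using compact_annulus cont_g K_subset by (intro borel_integrable_compact) (auto intro: continuous_on_subset)
  then show ?thesis by (rule set_integrable_subset) (use assms in auto)
qed

lemma integrable_g_param:
  assumes "level_param t \<gamma> P" "A \<in> sets borel" "A \<subseteq> {0..<P}"
  shows "set_integrable lborel A (\<lambda>s. g (\<gamma> s))"
proof -
  note \<gamma> = level_paramD[OF assms(1)]
  have "continuous_on {0..P} (\<lambda>s. g (\<gamma> s))"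
    by (intro continuous_on_compose2[OF cont_g \<gamma>(9)]) (use \<gamma>(3) in auto)
  then have "set_integrable lborel {0..P} (\<lambda>s. g (\<gamma> s))"
    unfolding set_integrable_def by (intro borel_integrable_compact) auto
  then show ?thesis by (rule set_integrable_subset) (use assms in auto)
qed

lemma param_vimage_borel:
  assumes "level_param t \<gamma> P" "B \<in> sets borel"
  shows "{0..<P} \<inter> \<gamma> -` B \<in> sets borel"
proof -
  have "\<gamma> \<in> borel_measurable borel"
    using level_paramD(9)[OF assms(1)] by (rule borel_measurable_continuous_onI)
  from measurable_sets[OF this assms(2)] have "\<gamma> -` B \<in> sets borel" by simp
  then show ?thesis by (intro sets.Int) auto
qed

text \<open>Formulated for Borel pieces of the annulus so that it can be proved in charts and added
  up. One function \<open>I\<close> must serve all parametrisations of a level, since a later choice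
  of starting point has to be compatible with every piece.\<close>

definition coarea :: "(real^2) set \<Rightarrow> bool" where
  "coarea B \<longleftrightarrow> (\<exists>I. integrable lborel I \<and> integral\<^sup>L lborel I = (LINT p:B|lborel. g p) \<and>
     (\<forall>t. t \<notin> {a..b} \<longrightarrow> I t = 0) \<and>
     (\<forall>t\<in>{a..b}. \<forall>\<gamma> P. level_param t \<gamma> P \<longrightarrow> I t = (LINT s:{0..<P} \<inter> \<gamma> -` B|lborel. g (\<gamma> s))))"

lemma coarea_Un:
  assumes "coarea A" "coarea B" and sets: "A \<in> sets borel" "B \<in> sets borel" "A \<subseteq> K" "B \<subseteq> K"
    and disj: "A \<inter> B = {}"
  shows "coarea (A \<union> B)"
proof -
  obtain I where I: "integrable lborel I" "integral\<^sup>L lborel I = (LINT p:A|lborel. g p)"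
    "\<forall>t. t \<notin> {a..b} \<longrightarrow> I t = 0"
    "\<forall>t\<in>{a..b}. \<forall>\<gamma> P. level_param t \<gamma> P \<longrightarrow> I t = (LINT s:{0..<P} \<inter> \<gamma> -` A|lborel. g (\<gamma> s))"
    using assms(1) unfolding coarea_def by blast
  obtain J where J: "integrable lborel J" "integral\<^sup>L lborel J = (LINT p:B|lborel. g p)"
    "\<forall>t. t \<notin> {a..b} \<longrightarrow> J t = 0"
    "\<forall>t\<in>{a..b}. \<forall>\<gamma> P. level_param t \<gamma> P \<longrightarrow> J t = (LINT s:{0..<P} \<inter> \<gamma> -` B|lborel. g (\<gamma> s))"
    using assms(2) unfolding coarea_def by blast
  have "(LINT p:A \<union> B|lborel. g p) = (LINT p:A|lborel. g p) + (LINT p:B|lborel. g p)"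
    by (intro set_integral_Un disj integrable_g sets)
  then have int: "integral\<^sup>L lborel (\<lambda>t. I t + J t) = (LINT p:A \<union> B|lborel. g p)"
    using I J by simp
  have lev: "I t + J t = (LINT s:{0..<P} \<inter> \<gamma> -` (A \<union> B)|lborel. g (\<gamma> s))"
    if "t \<in> {a..b}" "level_param t \<gamma> P" for t \<gamma> P
  proof -
    have "(LINT s:({0..<P} \<inter> \<gamma> -` A) \<union> ({0..<P} \<inter> \<gamma> -` B)|lborel. g (\<gamma> s))
        = (LINT s:{0..<P} \<inter> \<gamma> -` A|lborel. g (\<gamma> s)) + (LINT s:{0..<P} \<inter> \<gamma> -` B|lborel. g (\<gamma> s))"
      using disj by (intro set_integral_Un integrable_g_param[OF that(2)] param_vimage_borel[OF that(2)] sets) auto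
    moreover have "({0..<P} \<inter> \<gamma> -` A) \<union> ({0..<P} \<inter> \<gamma> -` B) = {0..<P} \<inter> \<gamma> -` (A \<union> B)" by auto
    ultimately show ?thesis using I(4) J(4) that by simp
  qed
  show ?thesis
    unfolding coarea_def
    by (intro exI[of _ "\<lambda>t. I t + J t"] conjI) (use I J int lev in auto)
qed

lemma coarea_empty: "coarea {}"
  unfolding coarea_def by (intro exI[of _ "\<lambda>_. 0"]) (simp add: set_lebesgue_integral_def)

lemma chart_deriv:
  assumes "p \<in> \<Omega>"
  shows "(chart e has_derivative (\<lambda>v. vector [e \<bullet> v, G p \<bullet> v])) (at p)"
proof -
  have eq: "(vector [x, y] :: real^2) = x *\<^sub>R axis 1 1 + y *\<^sub>R axis 2 1" for x y
    by (simp add: vec_eq_2 axis_def)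
  show ?thesis unfolding chart_def eq
    by (intro has_derivative_add has_derivative_scaleR_left has_derivative_inner_right
        has_derivative_ident f_deriv[OF assms])
qed

lemma det_chart: "det (matrix (\<lambda>v. vector [e \<bullet> v, G p \<bullet> v] :: real^2)) = - (e \<bullet> X p)"
  by (simp add: det_2 matrix_def axis_def X_def inner_2)

text \<open>In the coordinates \<open>(e \<bullet> p, f p)\<close> the area acquires the Jacobian
  \<open>e \<bullet> X p\<close>. After Fubini, substituting
  \<open>x = e \<bullet> \<gamma> s\<close> on a slice produces the same factor as
  \<open>dx / ds\<close>, so the two cancel and leave \<open>g\<close> integrated in Hamiltonian
  time.\<close>

lemma coarea_small:
  assumes U: "convex U" "open U" "U \<subseteq> \<Omega>" and pos: "\<And>p. p \<in> U \<Longrightarrow> 0 < e \<bullet> X p"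
    and B: "B \<in> sets borel" "B \<subseteq> K" "B \<subseteq> U"
  shows "coarea B"
proof -
  obtain h where hom: "homeomorphism U (chart e ` U) (chart e) h" and op: "open (chart e ` U)"
    using chart_homeomorphism[OF U pos] by blast
  have h: "h (chart e p) = p" if "p \<in> U" for p using hom that by (auto simp: homeomorphism_def)
  have conth: "continuous_on (chart e ` U) h" and hU: "h ` chart e ` U = U"
    using hom by (auto simp: homeomorphism_def)
  have injU: "inj_on (chart e) U" using h by (metis inj_onI)
  define C where "C = chart e ` B"
  define w where "w z = g (h z) / (e \<bullet> X (h z))" for z
  have C: "C \<subseteq> chart e ` U" using B(3) by (auto simp: C_def)
  have "C \<in> sets borel"
  proof -
    have "h \<in> measurable (restrict_space borel (chart e ` U)) borel"
      by (rule borel_measurable_continuous_on_restrict[OF conth])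
    then have "h -` B \<inter> space (restrict_space borel (chart e ` U)) \<in> sets (restrict_space borel (chart e ` U))"
      using B(1) by (rule measurable_sets)
    then have "h -` B \<inter> chart e ` U \<in> sets borel"
      using op by (simp add: sets_restrict_space_iff)
    moreover have "h -` B \<inter> chart e ` U = C" using B(3) h by (auto simp: C_def image_iff)
    ultimately show ?thesis by simp
  qed
  have contw: "continuous_on (chart e ` U) w"
    unfolding w_def using hU U(3) pos
    by (intro continuous_intros continuous_on_compose2[OF cont_g conth] continuous_on_compose2[OF cont_X conth])
       (auto simp: less_imp_neq[symmetric] h)
  have measw: "set_borel_measurable borel C w"
    using \<open>C \<in> sets borel\<close> op C contw by (intro set_borel_measurable_continuous_on) auto
  have ig: "set_integrable lborel B g" by (rule integrable_g[OF B(1,2)])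
  have "(\<lambda>p. \<bar>det (matrix (\<lambda>v. vector [e \<bullet> v, G p \<bullet> v] :: real^2))\<bar> * w (chart e p)) absolutely_integrable_on B \<and>
      integral B (\<lambda>p. \<bar>det (matrix (\<lambda>v. vector [e \<bullet> v, G p \<bullet> v] :: real^2))\<bar> * w (chart e p)) = integral B g
    \<longleftrightarrow> w absolutely_integrable_on (chart e ` B) \<and> integral (chart e ` B) w = integral B g"
  proof (rule has_absolute_integral_change_of_variables_real)
    show "B \<in> sets lebesgue" using B(1) by simp
    show "(chart e has_derivative (\<lambda>v. vector [e \<bullet> v, G p \<bullet> v])) (at p within B)" if "p \<in> B" for p
      using chart_deriv that B(3) U(3) has_derivative_at_withinI by blast
    show "inj_on (chart e) B" using injU B(3) inj_on_subset by blast
  qed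
  moreover have jac: "\<bar>det (matrix (\<lambda>v. vector [e \<bullet> v, G p \<bullet> v] :: real^2))\<bar> * w (chart e p) = g p" if "p \<in> B" for p
    using pos[of p] that B(3) h[of p] by (auto simp: det_chart w_def)
  then have "integral B (\<lambda>p. \<bar>det (matrix (\<lambda>v. vector [e \<bullet> v, G p \<bullet> v] :: real^2))\<bar> * w (chart e p)) = integral B g"
    by (intro Henstock_Kurzweil_Integration.integral_cong)
  moreover have "(\<lambda>p. \<bar>det (matrix (\<lambda>v. vector [e \<bullet> v, G p \<bullet> v] :: real^2))\<bar> * w (chart e p)) absolutely_integrable_on B"
    using set_integrable_lborel_imp_absolutely_integrable[OF ig] jac
    by (subst set_integrable_cong[OF refl refl, where f' = g]) auto
  ultimately have w: "w absolutely_integrable_on C" "integral C w = integral B g"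
    unfolding C_def by blast+
  have iw: "set_integrable lborel C w" using w(1) measw by (simp add: set_integrable_lborel_iff)
  \<comment> \<open>Extension by zero, so that Fubini applies over the whole plane and
    \<open>I\<close> vanishes at levels that do not meet \<open>B\<close>.\<close>
  define W where "W z = indicator C z *\<^sub>R w z" for z
  have iW: "integrable lborel W" using iw by (simp add: set_integrable_def W_def[abs_def])
  define I where "I t = (\<integral>x. W (vector [x, t]) \<partial>lborel)" for t
  have "integral\<^sup>L lborel I = integral\<^sup>L lborel W" unfolding I_def by (rule Fubini_real_2[OF iW])
  also have "\<dots> = integral C w"
    using set_borel_integral_eq_integral(2)[OF iw] by (simp add: set_lebesgue_integral_def W_def[abs_def])
  also have "\<dots> = (LINT p:B|lborel. g p)" using set_borel_integral_eq_integral(2)[OF ig] w(2) by simp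
  finally have intI: "integral\<^sup>L lborel I = (LINT p:B|lborel. g p)" .
  have mem: "vector [x, t] \<in> C \<longleftrightarrow> (\<exists>p\<in>B. e \<bullet> p = x \<and> f p = t)" for x t
    by (auto simp: C_def image_iff vec_eq_2)
  have out: "I t = 0" if "t \<notin> {a..b}" for t
  proof -
    have "vector [x, t] \<notin> C" for x using mem that B(2) by (auto simp: K_iff)
    then show ?thesis by (simp add: I_def W_def)
  qed
  have lev: "I t = (LINT s:{0..<P} \<inter> \<gamma> -` B|lborel. g (\<gamma> s))" if t: "t \<in> {a..b}" and param: "level_param t \<gamma> P" for t \<gamma> P
  proof -
    note \<gamma> = level_paramD[OF param]
    define A where "A = {0..<P} \<inter> \<gamma> -` B"
    define u where "u s = e \<bullet> \<gamma> s" for s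
    have A: "A \<in> sets borel" "A \<subseteq> {0..<P}"
      using param_vimage_borel[OF param B(1)] by (auto simp: A_def)
    have AB: "\<gamma> s \<in> B" "\<gamma> s \<in> U" if "s \<in> A" for s using that B(3) by (auto simp: A_def)
    have chart: "chart e (\<gamma> s) = vector [u s, t]" for s
      using \<gamma>(4)[of s] by (simp add: vec_eq_2 u_def)
    have igA: "set_integrable lborel A (\<lambda>s. g (\<gamma> s))" by (rule integrable_g_param[OF param A])
    have "(\<lambda>s. \<bar>e \<bullet> X (\<gamma> s)\<bar> * W (vector [u s, t])) absolutely_integrable_on A \<and>
        integral A (\<lambda>s. \<bar>e \<bullet> X (\<gamma> s)\<bar> * W (vector [u s, t])) = integral A (\<lambda>s. g (\<gamma> s))
      \<longleftrightarrow> (\<lambda>x. W (vector [x, t])) absolutely_integrable_on (u ` A) \<and>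
        integral (u ` A) (\<lambda>x. W (vector [x, t])) = integral A (\<lambda>s. g (\<gamma> s))"
    proof (rule has_absolute_integral_change_of_variables_1')
      show "A \<in> sets lebesgue" using A(1) by simp
      show "(u has_real_derivative e \<bullet> X (\<gamma> s)) (at s within A)" for s
        unfolding u_def using bounded_linear.has_vector_derivative[OF bounded_linear_inner_right \<gamma>(5)]
        by (simp add: has_real_derivative_iff_has_vector_derivative has_vector_derivative_at_within)
      show "inj_on u A"
      proof (rule inj_onI)
        fix s s' assume s: "s \<in> A" "s' \<in> A" "u s = u s'"
        then have "\<gamma> s = \<gamma> s'"
          using AB \<gamma>(4) by (intro chart_inj[OF U(1,3) pos]) (auto simp: u_def)
        then show "s = s'" using \<gamma>(7) s A(2) by (auto simp: inj_on_def)
      qed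
    qed
    moreover have jac1: "\<bar>e \<bullet> X (\<gamma> s)\<bar> * W (vector [u s, t]) = g (\<gamma> s)" if "s \<in> A" for s
    proof -
      have "vector [u s, t] \<in> C" using AB[OF that] by (auto simp: C_def chart[symmetric])
      then have "W (vector [u s, t]) = w (chart e (\<gamma> s))" by (simp add: W_def chart)
      then show ?thesis using pos[OF AB(2)[OF that]] h[OF AB(2)[OF that]] by (simp add: w_def)
    qed
    then have "integral A (\<lambda>s. \<bar>e \<bullet> X (\<gamma> s)\<bar> * W (vector [u s, t])) = integral A (\<lambda>s. g (\<gamma> s))"
      by (intro Henstock_Kurzweil_Integration.integral_cong)
    moreover have "(\<lambda>s. \<bar>e \<bullet> X (\<gamma> s)\<bar> * W (vector [u s, t])) absolutely_integrable_on A"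
      using set_integrable_lborel_imp_absolutely_integrable[OF igA] jac1
      by (subst set_integrable_cong[OF refl refl, where f' = "\<lambda>s. g (\<gamma> s)"]) auto
    ultimately have r: "(\<lambda>x. W (vector [x, t])) absolutely_integrable_on (u ` A)"
      "integral (u ` A) (\<lambda>x. W (vector [x, t])) = integral A (\<lambda>s. g (\<gamma> s))"
      by blast+
    \<comment> \<open>One period of \<open>\<gamma>\<close> covers the level set, hence every point
      of \<open>B\<close> at level \<open>t\<close> is met during the times in
      \<open>A\<close>.\<close>
    have zero: "W (vector [x, t]) = 0" if "x \<notin> u ` A" for x
    proof -
      have "vector [x, t] \<notin> C"
      proof
        assume "vector [x, t] \<in> C"
        then obtain p where p: "p \<in> B" "e \<bullet> p = x" "f p = t" using mem by blast
        then have "p \<in> level t" using B(2) K_subset by (auto simp: level_iff)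
        then obtain s where "s \<in> {0..<P}" "p = \<gamma> s" using \<gamma>(8) by blast
        then show False using p that by (auto simp: A_def u_def)
      qed
      then show ?thesis by (simp add: W_def)
    qed
    have eq: "(\<lambda>x. indicator (u ` A) x *\<^sub>R W (vector [x, t])) = (\<lambda>x. W (vector [x, t]))"
    proof
      fix x
      show "indicator (u ` A) x *\<^sub>R W (vector [x, t]) = W (vector [x, t])"
        using zero[of x] by (cases "x \<in> u ` A") simp_all
    qed
    have "W \<in> borel_measurable borel" using borel_measurable_integrable[OF iW] by simp
    moreover have "(\<lambda>x::real. vector [x, t] :: real^2) \<in> borel_measurable borel"
      by (intro borel_measurable_continuous_onI continuous_on_vector_2 continuous_intros)
    ultimately have "(\<lambda>x. W (vector [x, t])) \<in> borel_measurable borel"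
      by (metis (no_types) measurable_compose)
    then have meas: "set_borel_measurable borel (u ` A) (\<lambda>x. W (vector [x, t]))"
      unfolding set_borel_measurable_def eq .
    then have i: "set_integrable lborel (u ` A) (\<lambda>x. W (vector [x, t]))"
      using r(1) by (simp add: set_integrable_lborel_iff)
    have "I t = (LINT x:u ` A|lborel. W (vector [x, t]))"
      unfolding I_def set_lebesgue_integral_def eq ..
    also have "\<dots> = integral A (\<lambda>s. g (\<gamma> s))"
      using set_borel_integral_eq_integral(2)[OF i] r(2) by simp
    also have "\<dots> = (LINT s:A|lborel. g (\<gamma> s))"
      using set_borel_integral_eq_integral(2)[OF igA] by simp
    finally show ?thesis by (simp add: A_def)
  qed
  show ?thesis
    unfolding coarea_def
    by (intro exI[of _ I] conjI) (use intI out lev Fubini_real_2(1)[OF iW] in \<open>auto simp: I_def[abs_def]\<close>)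
qed

text \<open>Compactness reduces the annulus to finitely many chart balls, and additivity glues them
  once the overlaps have been removed.\<close>

lemma coarea_K: "coarea K"
proof -
  define r where "r q = (SOME r. 0 < r \<and> ball q r \<subseteq> \<Omega> \<and> (\<forall>p\<in>ball q r. 0 < X q \<bullet> X p))" for q
  have r: "0 < r q \<and> ball q (r q) \<subseteq> \<Omega> \<and> (\<forall>p\<in>ball q (r q). 0 < X q \<bullet> X p)" if "q \<in> K" for q
  proof -
    have "q \<in> \<Omega>" using that K_subset by blast
    then have "\<exists>r. 0 < r \<and> ball q r \<subseteq> \<Omega> \<and> (\<forall>p\<in>ball q r. 0 < X q \<bullet> X p)"
      by (rule local_tangent_direction) blast
    then show ?thesis unfolding r_def by (rule someI_ex)
  qed
  \<comment> \<open>The set \<open>B\<close> is kept arbitrary so that the induction hypothesis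
    applies to what remains after the newest ball has been taken away.\<close>
  have *: "coarea (B \<inter> (\<Union>q\<in>F. ball q (r q)))" if "finite F" "F \<subseteq> K" "B \<in> sets borel" "B \<subseteq> K" for F B
    using that
  proof (induction F arbitrary: B rule: finite_induct)
    case empty
    then show ?case using coarea_empty by simp
  next
    case (insert q F)
    let ?U = "ball q (r q)" and ?V = "\<Union>q\<in>F. ball q (r q)"
    have q: "q \<in> K" using insert by simp
    have V: "?V \<in> sets borel" by (intro borel_open open_UN ballI open_ball)
    have "coarea (B \<inter> ?U)"
      using r[OF q] insert by (intro coarea_small[of ?U "X q"]) auto
    moreover have "coarea ((B - ?U) \<inter> ?V)"
      using insert.prems by (intro insert.IH) auto
    ultimately have "coarea ((B \<inter> ?U) \<union> ((B - ?U) \<inter> ?V))"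
      using insert.prems V by (intro coarea_Un) auto
    also have "(B \<inter> ?U) \<union> ((B - ?U) \<inter> ?V) = B \<inter> (\<Union>q\<in>insert q F. ball q (r q))" by auto
    finally show ?case .
  qed
  obtain F where F: "F \<subseteq> K" "finite F" "K \<subseteq> (\<Union>q\<in>F. ball q (r q))"
    using compactE_image[OF compact_annulus, of K "\<lambda>q. ball q (r q)"] r by force
  have "K \<in> sets borel" using compact_annulus by (intro borel_compact)
  from *[OF F(2,1) this] have "coarea (K \<inter> (\<Union>q\<in>F. ball q (r q)))" by simp
  also have "K \<inter> (\<Union>q\<in>F. ball q (r q)) = K" using F(3) by blast
  finally show ?thesis .
qed

theorem integral_second_tangential_derivative:
  "\<exists>\<sigma>\<in>{1, -1}. (\<forall>p\<in>K. orientation_sign \<Omega> f p = \<sigma>) \<and>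
     (LINT p:K|lborel. g p) = \<sigma> * (2 * pi * (b - a))"
proof -
  obtain \<sigma> where \<sigma>: "\<sigma> \<in> {1, -1}" "\<forall>p\<in>K. orientation_sign \<Omega> f p = \<sigma>"
    "\<forall>t\<in>{a..b}. \<exists>\<gamma> P. level_param t \<gamma> P \<and> integral {0..P} (\<lambda>s. g (\<gamma> s)) = \<sigma> * (2 * pi)"
    by (rule orientation_and_turning)
  obtain I where I: "integral\<^sup>L lborel I = (LINT p:K|lborel. g p)"
    "\<forall>t. t \<notin> {a..b} \<longrightarrow> I t = 0"
    "\<forall>t\<in>{a..b}. \<forall>\<gamma> P. level_param t \<gamma> P \<longrightarrow> I t = (LINT s:{0..<P} \<inter> \<gamma> -` K|lborel. g (\<gamma> s))"
    using coarea_K unfolding coarea_def by blast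
  have "I t = indicator {a..b} t *\<^sub>R (\<sigma> * (2 * pi))" for t
  proof (cases "t \<in> {a..b}")
    case True
    then obtain \<gamma> P where \<gamma>: "level_param t \<gamma> P" "integral {0..P} (\<lambda>s. g (\<gamma> s)) = \<sigma> * (2 * pi)"
      using \<sigma>(3) by blast
    \<comment> \<open>For the full annulus no time is lost: the restricted level integral runs over
      a whole period and equals the total turning.\<close>
    have "{0..<P} \<inter> \<gamma> -` K = {0..<P}"
      using level_paramD(2)[OF \<gamma>(1)] level_subset_K[OF True] by blast
    then have "I t = (LINT s:{0..<P}|lborel. g (\<gamma> s))" using I(3) True \<gamma>(1) by metis
    also have "\<dots> = integral {0..<P} (\<lambda>s. g (\<gamma> s))"
      by (intro set_borel_integral_eq_integral integrable_g_param[OF \<gamma>(1)]) auto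
    also have "\<dots> = integral {0..P} (\<lambda>s. g (\<gamma> s))"
    proof (rule integral_subset_negligible)
      have "{0..P} - {0..<P} \<subseteq> {P}" by auto
      then show "negligible ({0..P} - {0..<P})" using negligible_subset negligible_sing by blast
    qed auto
    finally show ?thesis using True \<gamma>(2) by simp
  next
    case False
    then show ?thesis using I(2) by simp
  qed
  then have "I = (\<lambda>t. indicator {a..b} t *\<^sub>R (\<sigma> * (2 * pi)))" by (rule ext)
  then have "integral\<^sup>L lborel I = (LINT t:{a..b}|lborel. \<sigma> * (2 * pi))"
    by (simp only: set_lebesgue_integral_def)
  also have "\<dots> = \<sigma> * (2 * pi * (b - a))" 
  proof -
    have "set_integrable lborel {a..b} (\<lambda>t. \<sigma> * (2 * pi))"
      unfolding set_integrable_def by (intro borel_integrable_compact) auto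
    from set_borel_integral_eq_integral(2)[OF this] show ?thesis
      using a_less_b by (simp only: integral_const_real content_real) (simp add: algebra_simps)
  qed
  finally show ?thesis using \<sigma>(1,2) I(1) by auto
qed

end

theorem theorem3:
  fixes \<Omega> :: "(real^2) set" and f :: "real^2 \<Rightarrow> real" and a b :: real
  assumes "open \<Omega>" and "connected \<Omega>"
    and "Ck_on 2 \<Omega> f"
    and "\<forall>p\<in>\<Omega>. grad f p \<noteq> 0"
    and "a < b" and "a \<in> f ` \<Omega>" and "b \<in> f ` \<Omega>"
    and "connected (preimage_in \<Omega> f {a..b})"
    and "compact (preimage_in \<Omega> f {a..b})"
  shows "\<exists>\<sigma>\<in>{1, -1}.
    (\<forall>p\<in>preimage_in \<Omega> f {a..b}. orientation_sign \<Omega> f p = \<sigma>) \<and>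
    (LINT p:preimage_in \<Omega> f {a..b}|lborel. dir_deriv2 f (unit_tangent f p) p)
      = \<sigma> * (2 * pi * (b - a))"
proof -
  interpret level_annulus \<Omega> f a b
    using assms by unfold_locales auto
  show ?thesis by (rule integral_second_tangential_derivative)
qed

end
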